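(* Let $\alpha\ge 0$. Then the algorithm PC2 (defined in the context) is unconditionally well-posed for any input $\boldsymbol m_h^0\in\mathcal{S}^1(\mathcal{T}_h)^3$, i.e., for all $\ell=0,\dots,L-1$ and any $\boldsymbol m_h^\ell\in\mathcal{S}^1(\mathcal{T}_h)^3$, the predictor problem admits a unique solution $\boldsymbol v_h^\ell\in\mathcal{S}^1(\mathcal{T}_h)^3$, and the corrector problem admits a unique solution $\boldsymbol m_h^{\ell+1}\in\mathcal{S}^1(\mathcal{T}_h)^3$.
   Context: **Setting.** $\Omega\subset\mathbb{R}^3$ is a bounded Lipschitz domain with a regular (conforming) tetrahedral triangulation $\mathcal{T}_h$ of mesh size $h>0$; $\mathcal{N}_h$ is the set of vertices of $\mathcal{T}_h$. $T>0$, $L\in\mathbb{N}$, $k:=T/L>0$ is the uniform time-step size. $\alpha\ge 0$ (damping), $\ell_{\mathrm{ex}}>0$ (exchange length), $\theta\in[0,1]$ are constants. $\times$ is the cross product and $\cdot$ the scalar product in $\mathbb{R}^3$. **Discrete space.** $\mathcal{S}^1(\mathcal{T}_h)$ is the space of $\mathcal{T}_h$-piecewise linear, globally continuous functions $\overline\Omega\to\mathbb{R}$, with nodal basis $\{\phi_{\boldsymbol z}\}_{\boldsymbol z\in\mathcal{N}_h}$, $\phi_{\boldsymbol z}(\boldsymbol z')=\delta_{\boldsymbol z,\boldsymbol z'}$. **Mass-lumped product.** For continuous $\boldsymbol u,\boldsymbol w:\overline\Omega\to\mathbb{R}^3$, $$\langle\boldsymbol u,\boldsymbol w\rangle_h:=\sum_{\boldsymbol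 z\in\mathcal{N}_h}\beta_{\boldsymbol z}\,\boldsymbol u(\boldsymbol z)\cdot\boldsymbol w(\boldsymbol z),\qquad \beta_{\boldsymbol z}:=\int_\Omega\phi_{\boldsymbol z}\,d\boldsymbol x>0$$ (equivalently, the integral over $\Omega$ of the nodal interpolant of $\boldsymbol u\cdot\boldsymbol w$). $\langle\cdot,\cdot\rangle$ is the $L^2(\Omega)$-scalar product (for vector- or matrix-valued functions). **Discrete Laplacian.** For $\boldsymbol w\in H^1(\Omega;\mathbb{R}^3)$, $\boldsymbol\Delta_h\boldsymbol w\in\mathcal{S}^1(\mathcal{T}_h)^3$ is the unique function with $-\langle\boldsymbol\Delta_h\boldsymbol w,\boldsymbol w_h\rangle_h=\langle\nabla\boldsymbol w,\nabla\boldsymbol w_h\rangle$ for all $\boldsymbol w_h\in\mathcal{S}^1(\mathcal{T}_h)^3$. **Notation.** $\boldsymbol m_h^{\ell+1/2}:=(\boldsymbol m_h^{\ell+1}+\boldsymbol m_h^\ell)/2$ and $d_t\boldsymbol m_h^{\ell+1}:=(\boldsymbol m_h^{\ell+1}-\boldsymbol m_h^\ell)/k$. **Algorithm PC2** (here with input and iterates in $\mathcal{S}^1(\mathcal{T}_h)^3$, not necessarily of unit length at the vertices). Given $\boldsymbol m_h^0$, for $\ell=0,\dots,L-1$: (i) Predictor: compute $\boldsymbol v_h^\ell\in\mathcal{S}^1(\mathcal{T}_h)^3$ such that, for all $\boldsymbol w_h\in\mathcal{S}^1(\mathcal{T}_h)^3$, $$(1+\alpha^2)\langle\boldsymbol v_h^\ell,\boldsymbol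 w_h\rangle_h=-\ell_{\mathrm{ex}}^2\langle\boldsymbol m_h^\ell\times\boldsymbol\Delta_h(\boldsymbol m_h^\ell+\theta k\boldsymbol v_h^\ell),\boldsymbol w_h\rangle_h-\alpha\ell_{\mathrm{ex}}^2\langle\boldsymbol m_h^\ell\times(\boldsymbol m_h^\ell\times\boldsymbol\Delta_h(\boldsymbol m_h^\ell+\theta k\boldsymbol v_h^\ell)),\boldsymbol w_h\rangle_h.$$ (ii) Corrector: compute $\boldsymbol m_h^{\ell+1}$ such that, for all $\boldsymbol w_h\in\mathcal{S}^1(\mathcal{T}_h)^3$, $$\begin{aligned}(1+\alpha^2)\langle d_t\boldsymbol m_h^{\ell+1},\boldsymbol w_h\rangle_h&=-\ell_{\mathrm{ex}}^2\langle\boldsymbol m_h^{\ell+1/2}\times\boldsymbol\Delta_h(\boldsymbol m_h^\ell+(k/2)\boldsymbol v_h^\ell),\boldsymbol w_h\rangle_h\\&\quad-\alpha\ell_{\mathrm{ex}}^2\langle\boldsymbol m_h^{\ell+1/2}\times[(\boldsymbol m_h^\ell+(k/2)\boldsymbol v_h^\ell)\times\boldsymbol\Delta_h(\boldsymbol m_h^\ell+(k/2)\boldsymbol v_h^\ell)],\boldsymbol w_h\rangle_h.\end{aligned}$$ *)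

theory Defs
  imports "HOL-Analysis.Analysis"
begin

section \<open>Domain and mesh\<close>

text \<open>Near each boundary point, after an orthogonal change of coordinates, the set is the open
  region above the graph of a Lipschitz function of the first two coordinates.\<close>

definition lipschitz_boundary :: "(real^3) set \<Rightarrow> bool" where
  "lipschitz_boundary \<Omega> \<longleftrightarrow>
     (\<forall>p\<in>frontier \<Omega>. \<exists>(R :: real^3 \<Rightarrow> real^3) (\<gamma> :: real \<times> real \<Rightarrow> real) C r.
        orthogonal_transformation R \<and> C-lipschitz_on UNIV \<gamma> \<and> r > 0 \<and>
        \<Omega> \<inter> ball p r = {x \<in> ball p r. \<gamma> (R x $ 1, R x $ 2) < R x $ 3})"

definition bounded_lipschitz_domain :: "(real^3) set \<Rightarrow> bool" where
  "bounded_lipschitz_domain \<Omega> \<longleftrightarrow>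
     open \<Omega> \<and> connected \<Omega> \<and> \<Omega> \<noteq> {} \<and> bounded \<Omega> \<and> lipschitz_boundary \<Omega>"

text \<open>Conformity (any two elements meet in a common, possibly empty, face) is part of
  \<^const>\<open>triangulation\<close>.\<close>

definition tetrahedral_triangulation :: "(real^3) set \<Rightarrow> (real^3) set set \<Rightarrow> bool" where
  "tetrahedral_triangulation \<Omega> \<T> \<longleftrightarrow>
     triangulation \<T> \<and> (\<forall>K\<in>\<T>. 3 simplex K) \<and> \<Union>\<T> = closure \<Omega>"

definition mesh_vertices :: "(real^3) set set \<Rightarrow> (real^3) set" where
  "mesh_vertices \<T> = {z. \<exists>K\<in>\<T>. z extreme_point_of K}"

section \<open>Finite element space and mass lumping\<close>

text \<open>A function on \<^term>\<open>closure \<Omega>\<close> is represented by its extension by zero to all of \<open>\<real>\<^sup>3\<close>, so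
  that equality in the space is equality of HOL functions and the space is closed under
  pointwise linear combinations.\<close>

definition S1 :: "(real^3) set \<Rightarrow> (real^3) set set \<Rightarrow> (real^3 \<Rightarrow> real) set" where
  "S1 \<Omega> \<T> = {f. continuous_on (closure \<Omega>) f \<and>
                 (\<forall>K\<in>\<T>. \<exists>a b. \<forall>x\<in>K. f x = a \<bullet> x + b) \<and>
                 (\<forall>x. x \<notin> closure \<Omega> \<longrightarrow> f x = 0)}"

definition S1_vec :: "(real^3) set \<Rightarrow> (real^3) set set \<Rightarrow> (real^3 \<Rightarrow> real^3) set" where
  "S1_vec \<Omega> \<T> = {w. \<forall>i. (\<lambda>x. w x $ i) \<in> S1 \<Omega> \<T>}"

definition nodal_basis :: "(real^3) set \<Rightarrow> (real^3) set set \<Rightarrow> real^3 \<Rightarrow> real^3 \<Rightarrow> real" where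
  "nodal_basis \<Omega> \<T> z =
     (THE \<phi>. \<phi> \<in> S1 \<Omega> \<T> \<and> (\<forall>z'\<in>mesh_vertices \<T>. \<phi> z' = (if z' = z then 1 else 0)))"

definition lumping_weight :: "(real^3) set \<Rightarrow> (real^3) set set \<Rightarrow> real^3 \<Rightarrow> real" where
  "lumping_weight \<Omega> \<T> z = (LINT x|lebesgue_on \<Omega>. nodal_basis \<Omega> \<T> z x)"

definition mass_lumped ::
  "(real^3) set \<Rightarrow> (real^3) set set \<Rightarrow> (real^3 \<Rightarrow> real^3) \<Rightarrow> (real^3 \<Rightarrow> real^3) \<Rightarrow> real" where
  "mass_lumped \<Omega> \<T> u w = (\<Sum>z\<in>mesh_vertices \<T>. lumping_weight \<Omega> \<T> z * (u z \<bullet> w z))"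

section \<open>Sobolev space and discrete Laplacian\<close>

definition L2_space :: "(real^3) set \<Rightarrow> (real^3 \<Rightarrow> 'b::euclidean_space) set" where
  "L2_space \<Omega> = {f. f \<in> borel_measurable (lebesgue_on \<Omega>) \<and>
                     integrable (lebesgue_on \<Omega>) (\<lambda>x. (norm (f x))\<^sup>2)}"

definition L2_product ::
  "(real^3) set \<Rightarrow> (real^3 \<Rightarrow> 'b::euclidean_space) \<Rightarrow> (real^3 \<Rightarrow> 'b) \<Rightarrow> real" where
  "L2_product \<Omega> f g = (LINT x|lebesgue_on \<Omega>. f x \<bullet> g x)"

definition partial_deriv :: "3 \<Rightarrow> (real^3 \<Rightarrow> real) \<Rightarrow> real^3 \<Rightarrow> real" where
  "partial_deriv j \<phi> x = frechet_derivative \<phi> (at x) (axis j 1)"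

text \<open>Continuously differentiable functions with compact support in \<open>\<Omega>\<close>, extended by zero
  (the test functions of Gilbarg--Trudinger for first-order weak derivatives).\<close>

definition test_functions :: "(real^3) set \<Rightarrow> (real^3 \<Rightarrow> real) set" where
  "test_functions \<Omega> = {\<phi>. (\<forall>x. \<phi> differentiable (at x)) \<and>
                          (\<forall>j. continuous_on UNIV (partial_deriv j \<phi>)) \<and>
                          compact (closure {x. \<phi> x \<noteq> 0}) \<and>
                          closure {x. \<phi> x \<noteq> 0} \<subseteq> \<Omega>}"

text \<open>The entry \<open>G x $ i $ j\<close> represents the weak derivative of component \<open>i\<close> in direction \<open>j\<close>;
  the inner product of two such matrices is the Frobenius product.\<close>

definition is_weak_gradient ::
  "(real^3) set \<Rightarrow> (real^3 \<Rightarrow> real^3) \<Rightarrow> (real^3 \<Rightarrow> real^3^3) \<Rightarrow> bool" where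
  "is_weak_gradient \<Omega> w G \<longleftrightarrow>
     G \<in> L2_space \<Omega> \<and>
     (\<forall>\<phi>\<in>test_functions \<Omega>. \<forall>i j.
        (LINT x|lebesgue_on \<Omega>. w x $ i * partial_deriv j \<phi> x) =
        - (LINT x|lebesgue_on \<Omega>. G x $ i $ j * \<phi> x))"

definition H1_space :: "(real^3) set \<Rightarrow> (real^3 \<Rightarrow> real^3) set" where
  "H1_space \<Omega> = {w. w \<in> L2_space \<Omega> \<and> (\<exists>G. is_weak_gradient \<Omega> w G)}"

text \<open>The weak gradient is unique only up to null sets; any representative is chosen.\<close>

definition weak_gradient :: "(real^3) set \<Rightarrow> (real^3 \<Rightarrow> real^3) \<Rightarrow> real^3 \<Rightarrow> real^3^3" where
  "weak_gradient \<Omega> w = (SOME G. is_weak_gradient \<Omega> w G)"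

text \<open>Meaningful for \<^term>\<open>w \<in> H1_space \<Omega>\<close>.\<close>

definition discrete_laplacian ::
  "(real^3) set \<Rightarrow> (real^3) set set \<Rightarrow> (real^3 \<Rightarrow> real^3) \<Rightarrow> real^3 \<Rightarrow> real^3" where
  "discrete_laplacian \<Omega> \<T> w =
     (THE u. u \<in> S1_vec \<Omega> \<T> \<and>
        (\<forall>w\<^sub>h\<in>S1_vec \<Omega> \<T>.
           - mass_lumped \<Omega> \<T> u w\<^sub>h = L2_product \<Omega> (weak_gradient \<Omega> w) (weak_gradient \<Omega> w\<^sub>h)))"

section \<open>One step of the predictor-corrector scheme\<close>

context includes cross3_syntax
begin

definition predictor_eq ::
  "(real^3) set \<Rightarrow> (real^3) set set \<Rightarrow> real \<Rightarrow> real \<Rightarrow> real \<Rightarrow> real \<Rightarrow>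
   (real^3 \<Rightarrow> real^3) \<Rightarrow> (real^3 \<Rightarrow> real^3) \<Rightarrow> bool" where
  "predictor_eq \<Omega> \<T> \<alpha> l_ex \<theta> k m v \<longleftrightarrow>
     (let D = discrete_laplacian \<Omega> \<T> (\<lambda>x. m x + (\<theta> * k) *\<^sub>R v x)
      in \<forall>w\<in>S1_vec \<Omega> \<T>.
           (1 + \<alpha>\<^sup>2) * mass_lumped \<Omega> \<T> v w =
           - l_ex\<^sup>2 * mass_lumped \<Omega> \<T> (\<lambda>x. m x \<times> D x) w
           - \<alpha> * l_ex\<^sup>2 * mass_lumped \<Omega> \<T> (\<lambda>x. m x \<times> (m x \<times> D x)) w)"

definition corrector_eq ::
  "(real^3) set \<Rightarrow> (real^3) set set \<Rightarrow> real \<Rightarrow> real \<Rightarrow> real \<Rightarrow>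
   (real^3 \<Rightarrow> real^3) \<Rightarrow> (real^3 \<Rightarrow> real^3) \<Rightarrow> (real^3 \<Rightarrow> real^3) \<Rightarrow> bool" where
  "corrector_eq \<Omega> \<T> \<alpha> l_ex k m v m' \<longleftrightarrow>
     (let d\<^sub>t = (\<lambda>x. (m' x - m x) /\<^sub>R k);
          mid = (\<lambda>x. (m' x + m x) /\<^sub>R 2);
          p = (\<lambda>x. m x + (k / 2) *\<^sub>R v x);
          D = discrete_laplacian \<Omega> \<T> p
      in \<forall>w\<in>S1_vec \<Omega> \<T>.
           (1 + \<alpha>\<^sup>2) * mass_lumped \<Omega> \<T> d\<^sub>t w =
           - l_ex\<^sup>2 * mass_lumped \<Omega> \<T> (\<lambda>x. mid x \<times> D x) w
           - \<alpha> * l_ex\<^sup>2 * mass_lumped \<Omega> \<T> (\<lambda>x. mid x \<times> (p x \<times> D x)) w)"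

end

end

theory Submission
  imports Defs
begin

text \<open>
  Testing with the vectorial hat functions turns both equations into identities at the vertices,
  because every lumping weight is positive.

  The corrector then decouples into one \<open>3 \<times> 3\<close> system per vertex of the form
  \<open>c y + (y \<times> a)/2 = r\<close> with \<open>c > 0\<close>, and \<open>y \<bullet> (y \<times> a) = 0\<close> makes it injective.

  The predictor is a square linear system, so it suffices to treat the homogeneous problem
  \<open>c v + \<kappa> A (\<Delta>\<^sub>h v) = 0\<close>, where \<open>y \<bullet> A y = - \<alpha> l\<^sup>2 \<bar>m \<times> y\<bar>\<^sup>2 \<le> 0\<close>.  Testing with \<open>\<Delta>\<^sub>h v\<close>
  gives \<open>c \<parallel>\<nabla> v\<parallel>\<^sup>2 \<le> 0\<close>, hence \<open>\<Delta>\<^sub>h v = 0\<close> and \<open>v = 0\<close>.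

  This uses that the discrete Laplacian is linear, although the weak gradient is an arbitrary
  choice: a function of the finite element space has its elementwise gradient as a weak gradient, and
  weak gradients are unique up to null sets.
\<close>

section \<open>Piecewise affine functions on a tetrahedral mesh\<close>

text \<open>The predictor operator is dissipative only when paired with its own argument, and that
  argument is the discrete Laplacian of the unknown; this dictates the test function. The Dirichlet
  form is merely semidefinite, since constants have zero energy, so vanishing energy cannot give
  \<open>v = 0\<close> directly: it gives a vanishing Laplacian, and the zeroth-order term
  \<open>c v\<close> does the rest.

  Both \<open>discrete_laplacian\<close> and \<open>weak_gradient\<close> are description operators,
  so no algebraic law holds for them before existence and uniqueness are settled. Integration by
  parts is obtained without surface integrals over element faces: a nodal function times a test
  function is Lipschitz along coordinate lines, and the integral of its directional derivative
  vanishes by translation invariance. Uniqueness of weak gradients is the fundamental lemma; as test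
  functions are only required to be C1, bumps built from squared positive parts suffice.\<close>

lemma affine_nonneg_on_hull:
  fixes a :: "'a::euclidean_space"
  assumes "\<And>c. c \<in> C \<Longrightarrow> 0 \<le> a \<bullet> c + b" and "x \<in> convex hull C"
  shows "0 \<le> a \<bullet> x + b"
proof -
  have "{x. 0 \<le> a \<bullet> x + b} = {x. a \<bullet> x \<ge> - b}" by auto
  hence "convex {x. 0 \<le> a \<bullet> x + b}" by (simp add: convex_halfspace_ge)
  hence "convex hull C \<subseteq> {x. 0 \<le> a \<bullet> x + b}" using assms(1) by (intro hull_minimal) auto
  thus ?thesis using assms(2) by auto
qed

lemma affine_eq_on_hull:
  fixes a :: "'a::euclidean_space"
  assumes "\<And>c. c \<in> C \<Longrightarrow> a \<bullet> c + b = a' \<bullet> c + b'" and "x \<in> convex hull C"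
  shows "a \<bullet> x + b = a' \<bullet> x + b'"
proof -
  have "0 \<le> (a - a') \<bullet> x + (b - b')"
    by (rule affine_nonneg_on_hull[OF _ assms(2)]) (use assms(1) in \<open>fastforce simp: inner_diff_left\<close>)
  moreover have "0 \<le> (a' - a) \<bullet> x + (b' - b)"
    by (rule affine_nonneg_on_hull[OF _ assms(2)]) (use assms(1) in \<open>fastforce simp: inner_diff_left\<close>)
  ultimately show ?thesis by (simp add: inner_diff_left)
qed

text \<open>After translation by one vertex \<open>p\<close>, the differences to the other vertices
  are linearly independent, so a linear functional with prescribed values on them exists. Its Riesz
  vector, \<open>adjoint g 1\<close>, is the slope.\<close>

lemma affine_interpolation:
  fixes C :: "'a::euclidean_space set" and c :: "'a \<Rightarrow> real"
  assumes "\<not> affine_dependent C"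
  obtains a b where "\<And>x. x \<in> C \<Longrightarrow> a \<bullet> x + b = c x"
proof (cases "C = {}")
  case True
  thus ?thesis using that by blast
next
  case False
  then obtain p where p: "p \<in> C" by auto
  have ind: "independent ((\<lambda>x. - p + x) ` (C - {p}))"
    using affine_dependent_iff_dependent2[OF p] assms by simp
  obtain g :: "'a \<Rightarrow> real" where g: "linear g"
      "\<And>y. y \<in> (\<lambda>x. - p + x) ` (C - {p}) \<Longrightarrow> g y = c (y + p) - c p"
    using linear_independent_extend[OF ind, of "\<lambda>y. c (y + p) - c p"] by blast
  define a where "a = adjoint g 1"
  have ga: "g y = a \<bullet> y" for y
    using adjoint_works[OF g(1), of y 1] by (simp add: a_def inner_commute)
  have "a \<bullet> x + (c p - a \<bullet> p) = c x" if "x \<in> C" for x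
  proof (cases "x = p")
    case False
    hence "g (- p + x) = c x - c p" using g(2)[of "- p + x"] that by auto
    thus ?thesis by (simp add: ga inner_simps)
  qed simp
  thus ?thesis using that by blast
qed

locale tetrahedral_mesh =
  fixes \<Omega> :: "(real^3) set" and \<T> :: "(real^3) set set"
  assumes open_domain: "open \<Omega>" and bounded_domain: "bounded \<Omega>"
    and mesh: "tetrahedral_triangulation \<Omega> \<T>"
begin

abbreviation "N \<equiv> mesh_vertices \<T>"

lemma finite_mesh: "finite \<T>"
  and face: "\<And>K K'. K \<in> \<T> \<Longrightarrow> K' \<in> \<T> \<Longrightarrow> K \<inter> K' face_of K"
  and simplex3: "\<And>K. K \<in> \<T> \<Longrightarrow> 3 simplex K"
  and Union_mesh: "\<Union>\<T> = closure \<Omega>"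
  using mesh by (auto simp: tetrahedral_triangulation_def triangulation_def)

lemma tetrahedron:
  assumes "K \<in> \<T>"
  obtains C where "finite C" "\<not> affine_dependent C" "K = convex hull C"
    "C = {z. z extreme_point_of K}" "C \<subseteq> N"
proof -
  obtain C where C: "finite C" "\<not> affine_dependent C" "K = convex hull C"
    using simplex3[OF assms] unfolding simplex by blast
  moreover have "C = {z. z extreme_point_of K}"
    using extreme_point_of_convex_hull_affine_independent[OF C(2)] C(3) by auto
  moreover from this have "C \<subseteq> N" using assms by (auto simp: mesh_vertices_def)
  ultimately show ?thesis using that by blast
qed

lemma compact_element: "K \<in> \<T> \<Longrightarrow> compact K"
  and convex_element: "K \<in> \<T> \<Longrightarrow> convex K"
  by (metis tetrahedron finite_imp_compact_convex_hull convex_convex_hull)+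

lemma closed_element: "K \<in> \<T> \<Longrightarrow> closed K"
  by (simp add: compact_element compact_imp_closed)

lemma finite_vertices: "finite N"
proof -
  have "N = (\<Union>K\<in>\<T>. {z. z extreme_point_of K})" by (auto simp: mesh_vertices_def)
  moreover have "finite {z. z extreme_point_of K}" if "K \<in> \<T>" for K
    using tetrahedron[OF that] by metis
  ultimately show ?thesis using finite_mesh by simp
qed

lemma vertices_in_closure: "N \<subseteq> closure \<Omega>"
  unfolding Union_mesh[symmetric] by (auto simp: mesh_vertices_def extreme_point_of_def)

lemma S1_zero: "(\<lambda>x. 0) \<in> S1 \<Omega> \<T>"
  unfolding S1_def by (auto intro!: exI[of _ 0])

lemma S1_lincomb:
  assumes "f \<in> S1 \<Omega> \<T>" "g \<in> S1 \<Omega> \<T>"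
  shows "(\<lambda>x. s * f x + t * g x) \<in> S1 \<Omega> \<T>"
proof -
  have "\<exists>a b. \<forall>x\<in>K. s * f x + t * g x = a \<bullet> x + b" if K: "K \<in> \<T>" for K
  proof -
    obtain a b where 1: "\<forall>x\<in>K. f x = a \<bullet> x + b" using assms(1) K unfolding S1_def by blast
    obtain a' b' where 2: "\<forall>x\<in>K. g x = a' \<bullet> x + b'" using assms(2) K unfolding S1_def by blast
    show ?thesis
      by (rule exI[of _ "s *\<^sub>R a + t *\<^sub>R a'"], rule exI[of _ "s * b + t * b'"])
        (auto simp: 1 2 inner_simps algebra_simps)
  qed
  moreover have "continuous_on (closure \<Omega>) (\<lambda>x. s * f x + t * g x)"
    using assms by (auto simp: S1_def intro!: continuous_intros)
  ultimately show ?thesis using assms by (auto simp: S1_def)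
qed

text \<open>An affine function on a simplex is fixed by its vertex values; off the closure of the
  domain both functions are zero by the encoding of \<open>S1\<close>.\<close>

lemma S1_eqI:
  assumes "f \<in> S1 \<Omega> \<T>" "g \<in> S1 \<Omega> \<T>" and eq: "\<And>z. z \<in> N \<Longrightarrow> f z = g z"
  shows "f = g"
proof
  fix x
  show "f x = g x"
  proof (cases "x \<in> closure \<Omega>")
    case True
    then obtain K where K: "K \<in> \<T>" "x \<in> K" using Union_mesh by blast
    obtain C where C: "K = convex hull C" "C \<subseteq> N" using tetrahedron[OF K(1)] by metis
    have CK: "C \<subseteq> K" using C hull_subset by metis
    obtain a b where 1: "\<forall>x\<in>K. f x = a \<bullet> x + b" using assms(1) K unfolding S1_def by blast
    obtain a' b' where 2: "\<forall>x\<in>K. g x = a' \<bullet> x + b'" using assms(2) K unfolding S1_def by blast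
    have "a \<bullet> c + b = a' \<bullet> c + b'" if "c \<in> C" for c
      using eq[of c] 1 2 that C(2) CK by (metis subsetD)
    hence "a \<bullet> x + b = a' \<bullet> x + b'"
      using affine_eq_on_hull K C(1) by blast
    thus ?thesis using 1 2 K by simp
  next
    case False
    thus ?thesis using assms by (auto simp: S1_def)
  qed
qed

text \<open>Interpolating on each element separately is always possible; the point is that the
  pieces fit together, and this is where conformity of the mesh enters.\<close>

lemma nodal_interpolation:
  fixes c :: "real^3 \<Rightarrow> real"
  obtains f where "f \<in> S1 \<Omega> \<T>" "\<And>z. z \<in> N \<Longrightarrow> f z = c z"
proof -
  have "\<exists>a b. \<forall>z. z extreme_point_of K \<longrightarrow> a \<bullet> z + b = c z" if "K \<in> \<T>" for K
    using tetrahedron[OF that] affine_interpolation by (metis mem_Collect_eq)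
  then obtain a b where ab: "\<And>K z. K \<in> \<T> \<Longrightarrow> z extreme_point_of K \<Longrightarrow> a K \<bullet> z + b K = c z"
    by metis
  \<comment> \<open>The intersection is a face of both elements, so its extreme points are vertices
    of both, where the two affine pieces take the same value. By Krein-Milman the intersection is
    the hull of these points.\<close>
  have agree: "a K \<bullet> x + b K = a K' \<bullet> x + b K'"
    if K: "K \<in> \<T>" "K' \<in> \<T>" "x \<in> K" "x \<in> K'" for K K' x
  proof (rule affine_eq_on_hull[of "{z. z extreme_point_of (K \<inter> K')}"])
    show "x \<in> convex hull {z. z extreme_point_of (K \<inter> K')}"
      using Krein_Milman_Minkowski[of "K \<inter> K'"] K
      by (simp add: compact_Int compact_element convex_Int convex_element)
    fix z assume "z \<in> {z. z extreme_point_of (K \<inter> K')}"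
    hence "z extreme_point_of K" "z extreme_point_of K'"
      using extreme_point_of_face[OF face, of K K'] extreme_point_of_face[OF face, of K' K] K
      by (auto simp: Int_commute)
    thus "a K \<bullet> z + b K = a K' \<bullet> z + b K'" using ab K by simp
  qed
  \<comment> \<open>Any element containing \<open>x\<close> may be picked: by \<open>agree\<close>
    the choice does not affect the value.\<close>
  define \<kappa> where "\<kappa> x = (SOME K. K \<in> \<T> \<and> x \<in> K)" for x
  define f where "f x = (if x \<in> closure \<Omega> then a (\<kappa> x) \<bullet> x + b (\<kappa> x) else 0)" for x
  have f: "f x = a K \<bullet> x + b K" if "K \<in> \<T>" "x \<in> K" for K x
  proof -
    have "\<kappa> x \<in> \<T> \<and> x \<in> \<kappa> x" unfolding \<kappa>_def using someI[of "\<lambda>K. K \<in> \<T> \<and> x \<in> K"] that by blast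
    moreover have "x \<in> closure \<Omega>" using that Union_mesh by blast
    ultimately show ?thesis using agree[of "\<kappa> x" K x] that by (simp add: f_def)
  qed
  have "continuous_on (\<Union>K\<in>\<T>. K) f"
  proof (rule continuous_on_closed_Union)
    fix K assume K: "K \<in> \<T>"
    have "continuous_on K (\<lambda>x. a K \<bullet> x + b K)" by (intro continuous_intros)
    thus "continuous_on K f" by (rule continuous_on_eq) (simp add: f[OF K])
  qed (auto simp: finite_mesh closed_element)
  hence "f \<in> S1 \<Omega> \<T>" using f Union_mesh by (auto simp: S1_def f_def)
  moreover have "f z = c z" if "z \<in> N" for z
    using that ab f by (auto simp: mesh_vertices_def extreme_point_of_def)
  ultimately show ?thesis using that by blast
qed

text \<open>Interpolation provides a hat function and \<open>S1_eqI\<close> makes it unique, so the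
  \<open>THE\<close> in \<open>nodal_basis\<close> denotes it.\<close>

lemma
  assumes "z \<in> N"
  shows nodal_basis_in_S1: "nodal_basis \<Omega> \<T> z \<in> S1 \<Omega> \<T>"
    and nodal_basis_vertex: "\<And>z'. z' \<in> N \<Longrightarrow> nodal_basis \<Omega> \<T> z z' = (if z' = z then 1 else 0)"
proof -
  obtain f where f: "f \<in> S1 \<Omega> \<T>" "\<And>z'. z' \<in> N \<Longrightarrow> f z' = (if z' = z then 1 else 0)"
    using nodal_interpolation[of "\<lambda>z'. if z' = z then 1 else 0"] by blast
  have "nodal_basis \<Omega> \<T> z = f"
    unfolding nodal_basis_def
    by (rule the_equality) (use f in \<open>auto intro!: S1_eqI\<close>)
  thus "nodal_basis \<Omega> \<T> z \<in> S1 \<Omega> \<T>"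
    "\<And>z'. z' \<in> N \<Longrightarrow> nodal_basis \<Omega> \<T> z z' = (if z' = z then 1 else 0)"
    using f by auto
qed

lemma S1_nonneg:
  assumes "f \<in> S1 \<Omega> \<T>" "\<And>z. z \<in> N \<Longrightarrow> 0 \<le> f z"
  shows "0 \<le> f x"
proof (cases "x \<in> closure \<Omega>")
  case True
  then obtain K where K: "K \<in> \<T>" "x \<in> K" using Union_mesh by blast
  obtain C where C: "K = convex hull C" "C \<subseteq> N" using tetrahedron[OF K(1)] by metis
  have CK: "C \<subseteq> K" using C hull_subset by metis
  obtain a b where 1: "\<forall>x\<in>K. f x = a \<bullet> x + b" using assms(1) K unfolding S1_def by blast
  have "0 \<le> a \<bullet> x + b"
    by (rule affine_nonneg_on_hull[of C]) (use assms(2) 1 K C CK in force)+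
  thus ?thesis using 1 K by simp
next
  case False
  thus ?thesis using assms by (auto simp: S1_def)
qed

section \<open>Integrability over the domain and positivity of the lumping weights\<close>

lemma domain_lmeasurable: "\<Omega> \<in> lmeasurable"
  using open_domain bounded_domain by (simp add: lmeasurable_open)

lemma finite_measure_domain: "finite_measure (lebesgue_on \<Omega>)"
  using domain_lmeasurable by (rule finite_measure_lebesgue_on)

lemma S1_bounded:
  assumes "f \<in> S1 \<Omega> \<T>"
  obtains B where "B > 0" "\<And>x. \<bar>f x\<bar> \<le> B"
proof -
  have "compact (f ` closure \<Omega>)"
    using assms bounded_domain by (intro compact_continuous_image) (auto simp: S1_def)
  then obtain B where "B > 0" "\<forall>y\<in>f ` closure \<Omega>. norm y \<le> B"
    using compact_imp_bounded bounded_pos by metis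
  thus ?thesis using that assms by (force simp: S1_def)
qed

lemma S1_measurable:
  assumes "f \<in> S1 \<Omega> \<T>"
  shows "f \<in> borel_measurable (lebesgue_on \<Omega>)"
proof -
  have "continuous_on \<Omega> f" using assms closure_subset by (auto simp: S1_def intro: continuous_on_subset)
  thus ?thesis using open_domain by (intro continuous_imp_measurable_on_sets_lebesgue) auto
qed

lemma integrable_bounded_domain:
  fixes f :: "real^3 \<Rightarrow> 'b::euclidean_space"
  assumes "f \<in> borel_measurable (lebesgue_on \<Omega>)" "\<And>x. norm (f x) \<le> B"
  shows "integrable (lebesgue_on \<Omega>) f"
  using finite_measure_domain assms by (intro finite_measure.integrable_const_bound) auto

lemma S1_integrable: "f \<in> S1 \<Omega> \<T> \<Longrightarrow> integrable (lebesgue_on \<Omega>) f"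
  by (rule S1_bounded[of f], assumption, rule integrable_bounded_domain) (auto intro: S1_measurable)

text \<open>The hat function is nonnegative everywhere and at least 1/2 near its vertex, hence on a
  set of positive measure.\<close>

lemma lumping_weight_pos:
  assumes z: "z \<in> N"
  shows "lumping_weight \<Omega> \<T> z > 0"
proof -
  let ?\<phi> = "nodal_basis \<Omega> \<T> z"
  note S = nodal_basis_in_S1[OF z]
  have nn: "0 \<le> ?\<phi> x" for x
    by (rule S1_nonneg[OF S]) (simp add: nodal_basis_vertex[OF z])
  have cont: "continuous_on (closure \<Omega>) ?\<phi>" using S by (auto simp: S1_def)
  have z1: "?\<phi> z = 1" using nodal_basis_vertex[OF z z] by simp
  have zc: "z \<in> closure \<Omega>" using z vertices_in_closure by blast
  obtain d where d: "d > 0" "\<And>x. x \<in> closure \<Omega> \<Longrightarrow> dist x z < d \<Longrightarrow> dist (?\<phi> x) (?\<phi> z) < 1/2"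
    using cont zc unfolding continuous_on_iff by (metis half_gt_zero zero_less_one)
  \<comment> \<open>The vertex may lie on the boundary, so the ball is cut with
    \<open>\<Omega>\<close>; the cut is nonempty because \<open>z\<close> is in the closure, and an
    open nonempty set is not negligible.\<close>
  define U where "U = \<Omega> \<inter> ball z d"
  have U: "open U" "U \<noteq> {}" "U \<subseteq> \<Omega>"
    using open_domain zc d(1) closure_approachable[of z \<Omega>] by (auto simp: U_def dist_commute disjoint_iff)
  have U_meas: "U \<in> lmeasurable"
    using U bounded_domain by (meson bounded_subset lmeasurable_open)
  have half: "1/2 \<le> ?\<phi> x" if "x \<in> U" for x
  proof -
    have "dist (?\<phi> x) 1 < 1/2"
      using d(2)[of x] that closure_subset[of \<Omega>] z1 by (auto simp: U_def dist_commute)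
    thus ?thesis by (simp add: dist_real_def abs_if split: if_splits)
  qed
  have Ul: "U \<in> sets (lebesgue_on \<Omega>)"
    using U U_meas by (simp add: sets_restrict_space_iff fmeasurableD domain_lmeasurable)
  have "0 < measure lebesgue U"
    using U U_meas open_not_negligible negligible_iff_measure zero_less_measure_iff by blast
  also have "measure lebesgue U = measure (lebesgue_on \<Omega>) U"
    using U domain_lmeasurable by (simp add: measure_restrict_space fmeasurableD)
  finally have "0 < 1/2 * measure (lebesgue_on \<Omega>) U" by simp
  also have "\<dots> = (LINT x|lebesgue_on \<Omega>. 1/2 * indicator U x)"
    using Ul U finite_measure_domain
    by (simp add: finite_measure.emeasure_finite less_top[symmetric] Int_absorb2)
  also have "\<dots> \<le> (LINT x|lebesgue_on \<Omega>. ?\<phi> x)"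
  proof (rule integral_mono)
    show "integrable (lebesgue_on \<Omega>) (\<lambda>x. 1/2 * indicator U x :: real)"
      using Ul finite_measure_domain
      by (intro integrable_mult_right) (simp add: finite_measure.emeasure_finite less_top[symmetric])
    show "integrable (lebesgue_on \<Omega>) ?\<phi>" by (rule S1_integrable[OF S])
    show "1/2 * indicator U x \<le> ?\<phi> x" for x using half nn by (auto simp: indicator_def)
  qed
  finally show ?thesis by (simp add: lumping_weight_def)
qed

end

section \<open>The fundamental lemma of the calculus of variations\<close>

lemma partial_deriv_eqI: "(f has_derivative f') (at x) \<Longrightarrow> partial_deriv j f x = f' (axis j 1)"
  unfolding partial_deriv_def using frechet_derivative_at by metis

text \<open>The regularity half of \<open>test_functions\<close>, separated from the support
  condition so that products and compositions can be formed factor by factor.\<close>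

definition C1 :: "(real^3 \<Rightarrow> real) \<Rightarrow> bool" where
  "C1 f \<longleftrightarrow> (\<forall>x. f differentiable (at x)) \<and> (\<forall>j. continuous_on UNIV (partial_deriv j f))"

lemma C1I:
  assumes "\<And>x. (f has_derivative f' x) (at x)" "\<And>j. continuous_on UNIV (\<lambda>x. f' x (axis j 1))"
  shows "C1 f"
proof -
  have "partial_deriv j f = (\<lambda>x. f' x (axis j 1))" for j
    using partial_deriv_eqI[OF assms(1)] by blast
  thus ?thesis using assms by (auto simp: C1_def differentiable_def)
qed

lemma C1_has_derivative:
  "C1 f \<Longrightarrow> (f has_derivative frechet_derivative f (at x)) (at x)"
  by (simp add: C1_def frechet_derivative_works)

lemma C1_continuous: "C1 f \<Longrightarrow> continuous_on UNIV f"
  by (simp add: C1_def differentiable_imp_continuous_on differentiable_on_def differentiable_at_imp_differentiable_on)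

lemma C1_partial: "C1 f \<Longrightarrow> continuous_on UNIV (\<lambda>x. frechet_derivative f (at x) (axis j 1))"
  unfolding C1_def partial_deriv_def by (simp add: fun_eq_iff)

lemma C1_mult:
  assumes "C1 f" "C1 g"
  shows "C1 (\<lambda>x. f x * g x)"
proof (rule C1I)
  fix x
  show "((\<lambda>x. f x * g x) has_derivative
    (\<lambda>h. f x * frechet_derivative g (at x) h + frechet_derivative f (at x) h * g x)) (at x)"
    by (intro has_derivative_mult C1_has_derivative assms)
qed (intro continuous_intros C1_continuous C1_partial assms)

lemma C1_compose:
  assumes "C1 f" "\<And>t. (F has_real_derivative F' t) (at t)" "continuous_on UNIV F'"
  shows "C1 (\<lambda>x. F (f x))"
proof (rule C1I)
  fix x
  show "((\<lambda>x. F (f x)) has_derivative (\<lambda>h. F' (f x) * frechet_derivative f (at x) h)) (at x)"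
    using has_derivative_compose[OF C1_has_derivative[OF assms(1)] assms(2)[unfolded has_field_derivative_def]]
    by simp
next
  fix j
  have "continuous_on UNIV (\<lambda>x. F' (f x))"
    using continuous_on_compose2[OF assms(3) C1_continuous[OF assms(1)]] by simp
  thus "continuous_on UNIV (\<lambda>x. F' (f x) * frechet_derivative f (at x) (axis j 1))"
    by (intro continuous_intros C1_partial assms)
qed

lemma C1_prod: "finite I \<Longrightarrow> (\<And>i. i \<in> I \<Longrightarrow> C1 (f i)) \<Longrightarrow> C1 (\<lambda>x. \<Prod>i\<in>I. f i x)"
proof (induction I rule: finite_induct)
  case empty
  show ?case by (rule C1I[where f' = "\<lambda>_ _. 0"]) auto
qed (simp add: C1_mult)

text \<open>Squaring removes the kink of the positive part: at 0 the difference quotient is bounded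
  by \<open>\<bar>h\<bar>\<close>.\<close>

lemma has_real_derivative_max0_sq:
  "((\<lambda>t. (max 0 t)\<^sup>2) has_real_derivative 2 * max 0 t) (at (t::real))"
proof (cases "t = 0")
  case True
  have "\<forall>\<^sub>F h in at (0::real). \<bar>(max 0 h)\<^sup>2 / h\<bar> \<le> \<bar>h\<bar>"
    by (auto intro!: always_eventually simp: max_def power2_eq_square)
  hence "((\<lambda>h::real. (max 0 h)\<^sup>2 / h) \<longlongrightarrow> 0) (at 0)"
    by (intro Lim_null_comparison[OF _ tendsto_rabs_zero[OF tendsto_ident_at]]) auto
  thus ?thesis using True by (simp add: DERIV_def)
next
  case False
  show ?thesis
  proof (cases "t > 0")
    case True
    have "((\<lambda>t. t\<^sup>2) has_real_derivative 2 * t) (at t)" by (auto intro!: derivative_eq_intros)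
    hence "((\<lambda>t. (max 0 t)\<^sup>2) has_real_derivative 2 * t) (at t)"
      by (rule has_field_derivative_transform_within_open[where S = "{0<..}"]) (use True in auto)
    thus ?thesis using True by simp
  next
    case F: False
    hence "t < 0" using False by simp
    have "((\<lambda>t. 0) has_real_derivative 0) (at t)" by simp
    hence "((\<lambda>t. (max 0 t)\<^sup>2) has_real_derivative 0) (at t)"
      by (rule has_field_derivative_transform_within_open[where S = "{..<0}"]) (use \<open>t < 0\<close> in auto)
    thus ?thesis using F by simp
  qed
qed

definition bump :: "real^3 \<Rightarrow> real^3 \<Rightarrow> real^3 \<Rightarrow> real" where
  "bump a b x = (\<Prod>i\<in>UNIV. (max 0 ((x $ i - a $ i) * (b $ i - x $ i)))\<^sup>2)"

lemma bump_pos: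
  assumes "x \<in> box a b"
  shows "bump a b x > 0"
  unfolding bump_def
proof (intro prod_pos ballI)
  fix i :: 3
  have "0 < (x $ i - a $ i) * (b $ i - x $ i)" using assms by (simp add: mem_box_cart)
  thus "0 < (max 0 ((x $ i - a $ i) * (b $ i - x $ i)))\<^sup>2"
    by (metis less_max_iff_disj zero_less_power)
qed

text \<open>A nonempty box guarantees \<open>a $ i < b $ i\<close> in every coordinate. With swapped
  corners the quadratic factor would be positive between \<open>b $ i\<close> and
  \<open>a $ i\<close>, although the box is empty.\<close>

lemma bump_zero:
  assumes "x \<notin> box a b" "box a b \<noteq> {}"
  shows "bump a b x = 0"
proof -
  obtain i where i: "\<not> (a $ i < x $ i \<and> x $ i < b $ i)" using assms(1) by (auto simp: mem_box_cart)
  have "a $ i < b $ i" using assms(2) by (auto simp: interval_eq_empty_cart not_le)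
  hence "(x $ i - a $ i) * (b $ i - x $ i) \<le> 0" using i by (auto simp: mult_le_0_iff)
  hence "\<exists>i\<in>UNIV. (max 0 ((x $ i - a $ i) * (b $ i - x $ i)))\<^sup>2 = 0" by (intro bexI[of _ i]) auto
  thus ?thesis unfolding bump_def by (intro prod_zero) auto
qed

lemma C1_bump: "C1 (bump a b)"
  unfolding bump_def
proof (intro C1_prod)
  fix i :: 3
  have "C1 (\<lambda>x. (x $ i - a $ i) * (b $ i - x $ i))"
    by (rule C1I[where f' = "\<lambda>x h. h $ i * (b $ i - x $ i) - (x $ i - a $ i) * h $ i"])
      (auto intro!: derivative_eq_intros continuous_intros bounded_linear.has_derivative[OF bounded_linear_vec_nth])
  thus "C1 (\<lambda>x. (max 0 ((x $ i - a $ i) * (b $ i - x $ i)))\<^sup>2)"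
    by (rule C1_compose[OF _ has_real_derivative_max0_sq]) (intro continuous_intros)
qed simp

text \<open>Applied to a bump function of a box, these converge to the indicator of the box.\<close>

definition cutoff :: "nat \<Rightarrow> real \<Rightarrow> real" where
  "cutoff n t = 1 - 1 / (1 + real n * t\<^sup>2)"

lemma cutoff_bounds: "\<bar>cutoff n t\<bar> \<le> 1"
proof -
  have "0 < 1 + real n * t\<^sup>2" by (simp add: add_pos_nonneg)
  hence "1 / (1 + real n * t\<^sup>2) \<le> 1" "1 / (1 + real n * t\<^sup>2) \<ge> 0"
    by (simp_all add: divide_le_eq_1)
  thus ?thesis unfolding cutoff_def by linarith
qed

lemma cutoff_zero [simp]: "cutoff n 0 = 0"
  by (simp add: cutoff_def)

lemma cutoff_tendsto: "t \<noteq> 0 \<Longrightarrow> (\<lambda>n. cutoff n t) \<longlonglongrightarrow> 1"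
proof -
  assume "t \<noteq> 0"
  hence "filterlim (\<lambda>n. real n * t\<^sup>2) at_top sequentially"
    by (intro filterlim_at_top_mult_tendsto_pos[OF tendsto_const _ filterlim_real_sequentially]) auto
  hence "filterlim (\<lambda>n. 1 + real n * t\<^sup>2) at_top sequentially"
    by (rule filterlim_tendsto_add_at_top[OF tendsto_const])
  hence "(\<lambda>n. 1 / (1 + real n * t\<^sup>2)) \<longlonglongrightarrow> 0"
    by (simp add: tendsto_divide_0[OF tendsto_const] filterlim_at_top_imp_at_infinity)
  from tendsto_diff[OF tendsto_const this, of 1] show ?thesis by (simp add: cutoff_def)
qed

lemma cutoff_test_function:
  assumes "cbox a b \<subseteq> \<Omega>" "box a b \<noteq> {}"
  shows "(\<lambda>x. cutoff n (bump a b x)) \<in> test_functions \<Omega>"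
proof -
  have pos: "1 + real n * t\<^sup>2 > 0" for t by (simp add: add_pos_nonneg)
  have "C1 (\<lambda>x. cutoff n (bump a b x))"
  proof (rule C1_compose[OF C1_bump])
    fix t
    show "(cutoff n has_real_derivative (2 * real n * t) / (1 + real n * t\<^sup>2)\<^sup>2) (at t)"
      unfolding cutoff_def using pos[of t]
      by (auto intro!: derivative_eq_intros simp: power2_eq_square)
    show "continuous_on UNIV (\<lambda>t. (2 * real n * t) / (1 + real n * t\<^sup>2)\<^sup>2)"
      by (intro continuous_intros) (metis pos less_irrefl power_eq_0_iff)
  qed
  \<comment> \<open>Since \<open>cutoff n 0 = 0\<close>, the composition vanishes wherever the bump
    does, so its support stays in the compact box \<open>cbox a b\<close>.\<close>
  moreover have "closure {x. cutoff n (bump a b x) \<noteq> 0} \<subseteq> cbox a b"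
    using bump_zero[OF _ assms(2)] box_subset_cbox[of a b]
    by (intro closure_minimal) (auto simp: closed_cbox, metis cutoff_zero subsetD)
  ultimately show ?thesis using assms(1)
    by (auto simp: test_functions_def C1_def compact_eq_bounded_closed
        intro: bounded_subset[OF bounded_cbox])
qed

text \<open>The cut-off bumps are bounded by 1 and tend pointwise to the indicator of the open box,
  so dominated convergence with majorant \<open>\<bar>g x\<bar>\<close> carries the vanishing
  integral over to the limit.\<close>

lemma integral_box_eq_0:
  fixes g :: "real^3 \<Rightarrow> real"
  assumes \<Omega>: "open \<Omega>" and g: "integrable (lebesgue_on \<Omega>) g"
    and test: "\<And>\<phi>. \<phi> \<in> test_functions \<Omega> \<Longrightarrow> (LINT x|lebesgue_on \<Omega>. g x * \<phi> x) = 0"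
    and ab: "cbox a b \<subseteq> \<Omega>"
  shows "(LINT x|lebesgue_on \<Omega>. g x * indicator (box a b) x) = 0"
proof (cases "box a b = {}")
  case False
  have "(\<lambda>n. LINT x|lebesgue_on \<Omega>. g x * cutoff n (bump a b x))
      \<longlonglongrightarrow> (LINT x|lebesgue_on \<Omega>. g x * indicator (box a b) x)"
  proof (rule integral_dominated_convergence[where w = "\<lambda>x. \<bar>g x\<bar>"])
    have "(indicator (box a b) :: real^3 \<Rightarrow> real) \<in> borel_measurable lebesgue"
      by (rule borel_measurable_indicator) simp
    hence "(indicator (box a b) :: real^3 \<Rightarrow> real) \<in> borel_measurable (lebesgue_on \<Omega>)"
      by (rule measurable_restrict_space1)
    thus "(\<lambda>x. g x * indicator (box a b) x) \<in> borel_measurable (lebesgue_on \<Omega>)"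
      by (rule borel_measurable_times[OF borel_measurable_integrable[OF g]])
    show "(\<lambda>x. g x * cutoff n (bump a b x)) \<in> borel_measurable (lebesgue_on \<Omega>)" for n
    proof -
      have "continuous_on UNIV (\<lambda>x. cutoff n (bump a b x))"
        using cutoff_test_function[OF ab False]
        by (auto simp: test_functions_def intro: differentiable_imp_continuous_on simp: differentiable_on_def differentiable_at_imp_differentiable_on)
      hence "(\<lambda>x. cutoff n (bump a b x)) \<in> borel_measurable (lebesgue_on \<Omega>)"
        using \<Omega> by (intro continuous_imp_measurable_on_sets_lebesgue) (auto intro: continuous_on_subset)
      thus ?thesis by (rule borel_measurable_times[OF borel_measurable_integrable[OF g]])
    qed
    show "integrable (lebesgue_on \<Omega>) (\<lambda>x. \<bar>g x\<bar>)" using g by (rule integrable_abs)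
    show "AE x in lebesgue_on \<Omega>. (\<lambda>n. g x * cutoff n (bump a b x)) \<longlonglongrightarrow> g x * indicator (box a b) x"
    proof (rule AE_I2)
      fix x
      have "(\<lambda>n. cutoff n (bump a b x)) \<longlonglongrightarrow> indicator (box a b) x"
        using cutoff_tendsto[of "bump a b x"] bump_pos[of x a b] bump_zero[OF _ False, of x]
        by (cases "x \<in> box a b") auto
      thus "(\<lambda>n. g x * cutoff n (bump a b x)) \<longlonglongrightarrow> g x * indicator (box a b) x"
        by (intro tendsto_intros)
    qed
    show "AE x in lebesgue_on \<Omega>. norm (g x * cutoff n (bump a b x)) \<le> \<bar>g x\<bar>" for n
      using cutoff_bounds[of n] by (auto simp: abs_mult mult_left_le)
  qed
  thus ?thesis
    using test[OF cutoff_test_function[OF ab False]] by (simp add: LIMSEQ_const_iff)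
qed simp

text \<open>Boxes are stable under intersection and generate the Borel sets, so a Dynkin argument
  extends the vanishing integral to every Borel set. Lebesgue sets differ from Borel sets by null
  sets, and a function with zero integral over every measurable set vanishes almost
  everywhere.\<close>

lemma AE_zero_if_boxes:
  fixes f :: "'a::euclidean_space \<Rightarrow> real"
  assumes f: "integrable lebesgue f" and total: "integral\<^sup>L lebesgue f = 0"
    and boxes: "\<And>a b. (LINT x:box a b|lebesgue. f x) = 0"
  shows "AE x in lebesgue. f x = 0"
proof (rule sigma_finite_measure.density_zero[OF _ f])
  show "sigma_finite_measure (lebesgue :: 'a measure)"
  proof
    obtain A :: "'a set set" where A: "countable A" "A \<subseteq> sets lborel" "\<Union>A = space lborel"
        "\<forall>a\<in>A. emeasure lborel a \<noteq> \<infinity>"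
      using lborel.sigma_finite_countable by metis
    have "A \<subseteq> sets lebesgue" "\<forall>a\<in>A. emeasure lebesgue a \<noteq> \<infinity>"
      using A(2,4) by (auto dest!: subsetD simp: emeasure_completion)
    thus "\<exists>A. countable A \<and> A \<subseteq> sets lebesgue \<and> \<Union>A = space lebesgue \<and>
        (\<forall>a\<in>A. emeasure lebesgue (a :: 'a set) \<noteq> \<infinity>)"
      using A by (intro exI[of _ A]) simp
  qed
  have set_f: "set_integrable lebesgue A f" if "A \<in> sets lebesgue" for A
    unfolding set_integrable_def by (rule integrable_mult_indicator[OF that f])
  have boxes_borel: "sigma_sets UNIV (range (\<lambda>(a, b). box a b :: 'a set)) = sets borel"
    by (simp add: borel_eq_box)
  have borel: "(LINT x:A|lebesgue. f x) = 0" if A: "A \<in> sets borel" for A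
  proof -
    have "Int_stable (range (\<lambda>(a, b). box a b :: 'a set))"
      by (auto simp: Int_stable_def box_Int_box)
    moreover have "range (\<lambda>(a, b). box a b :: 'a set) \<subseteq> Pow UNIV" by simp
    moreover have "A \<in> sigma_sets UNIV (range (\<lambda>(a, b). box a b))"
      using A by (simp add: borel_eq_box)
    ultimately show ?thesis
    proof (induction rule: sigma_sets_induct_disjoint)
      case (basic A)
      thus ?case using boxes by auto
    next
      \<comment> \<open>The whole space is not a box, so passing to complements requires the
        hypothesis \<open>total\<close>.\<close>
      case (compl A)
      hence A: "A \<in> sets lebesgue" by (simp add: boxes_borel)
      have "(LINT x:A|lebesgue. f x) + (LINT x:UNIV - A|lebesgue. f x) = (LINT x:A \<union> (UNIV - A)|lebesgue. f x)"
        using A by (intro set_integral_Un[symmetric] set_f) auto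
      thus ?case using compl total by (simp add: set_lebesgue_integral_def)
    next
      case (union A)
      hence A: "A i \<in> sets lebesgue" for i by (auto simp: boxes_borel)
      have "(LINT x:(\<Union>i. A i)|lebesgue. f x) = (\<Sum>i. LINT x:A i|lebesgue. f x)"
        using union(1) A by (intro lebesgue_integral_countable_add set_f) (auto simp: disjoint_family_on_def)
      thus ?case using union by simp
    qed (auto simp: set_lebesgue_integral_def)
  qed
  fix A :: "'a set" assume A: "A \<in> sets lebesgue"
  obtain S N N' where S: "A = S \<union> N" "N \<subseteq> N'" "N' \<in> null_sets lborel" "S \<in> sets lborel"
    using A by (metis sets_completionE)
  have "AE x in lebesgue. x \<notin> N'"
    using S(3) by (intro AE_not_in) (auto simp: null_sets_completionI)
  hence "AE x in lebesgue. indicator A x *\<^sub>R f x = indicator S x *\<^sub>R f x"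
    by eventually_elim (use S in \<open>auto simp: indicator_def\<close>)
  hence "(LINT x:A|lebesgue. f x) = (LINT x:S|lebesgue. f x)"
    unfolding set_lebesgue_integral_def using set_f[unfolded set_integrable_def] A S(4)
    by (intro integral_cong_AE) (auto intro!: borel_measurable_integrable simp del: real_scaleR_def)
  thus "(LINT x:A|lebesgue. f x) = 0" using borel S(4) by simp
qed

text \<open>Vanishing integrals are known only for boxes whose closure lies in
  \<open>\<Omega>\<close>. The argument is therefore run inside one such box at a time, and
  countably many of these exhaust the open set.\<close>

lemma fundamental_lemma_calculus_of_variations:
  fixes g :: "real^3 \<Rightarrow> real"
  assumes \<Omega>: "open \<Omega>" and g: "integrable (lebesgue_on \<Omega>) g"
    and test: "\<And>\<phi>. \<phi> \<in> test_functions \<Omega> \<Longrightarrow> (LINT x|lebesgue_on \<Omega>. g x * \<phi> x) = 0"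
  shows "AE x in lebesgue_on \<Omega>. g x = 0"
proof -
  have \<Omega>': "\<Omega> \<in> sets lebesgue" using \<Omega> by simp
  define f where "f x = indicator \<Omega> x * g x" for x
  have f: "integrable lebesgue f" using g \<Omega>' by (simp add: integrable_restrict_space f_def[abs_def])
  have box0: "(LINT x:box a b|lebesgue. f x) = 0" if "cbox a b \<subseteq> \<Omega>" for a b
  proof -
    have "(LINT x:box a b|lebesgue. f x) = (LINT x|lebesgue_on \<Omega>. g x * indicator (box a b) x)"
      using \<Omega>' by (simp add: integral_restrict_space set_lebesgue_integral_def f_def mult_ac)
    thus ?thesis using integral_box_eq_0[OF assms that] by simp
  qed
  have AE_box: "AE x in lebesgue. x \<in> cbox c d \<longrightarrow> f x = 0" if cd: "cbox c d \<subseteq> \<Omega>" for c d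
  proof -
    \<comment> \<open>Truncation makes all boxes of the space admissible: a box cut with
      \<open>box c d\<close> is again a box, and its closed counterpart lies in
      \<open>cbox c d\<close>. The truncated function differs from \<open>f\<close> on
      \<open>cbox c d\<close> only on the boundary, which is negligible.\<close>
    let ?f = "\<lambda>x. indicator (box c d) x * f x"
    have "AE x in lebesgue. ?f x = 0"
    proof (rule AE_zero_if_boxes)
      show "integrable lebesgue ?f"
        using integrable_mult_indicator[OF _ f, of "box c d"] by simp
      show "integral\<^sup>L lebesgue ?f = 0" using box0[OF cd] by (simp add: set_lebesgue_integral_def)
      fix a b :: "real^3"
      obtain u v where uv: "box a b \<inter> box c d = box u v" "cbox a b \<inter> cbox c d = cbox u v"
        unfolding box_Int_box Int_interval by blast
      have "(LINT x:box a b|lebesgue. ?f x) = (LINT x:box a b \<inter> box c d|lebesgue. f x)"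
        by (simp add: set_lebesgue_integral_def indicator_inter_arith mult.assoc)
      thus "(LINT x:box a b|lebesgue. ?f x) = 0" using box0[of u v] uv cd by auto
    qed
    moreover have "AE x in lebesgue. x \<notin> cbox c d - box c d"
      using negligible_frontier_interval by (intro AE_not_in) (simp add: negligible_iff_null_sets)
    ultimately show ?thesis by eventually_elim (auto simp: indicator_def)
  qed
  obtain D where D: "countable D" "\<And>X. X \<in> D \<Longrightarrow> X \<subseteq> \<Omega> \<and> (\<exists>a b. X = cbox a b)" "\<Union>D = \<Omega>"
    using open_countable_Union_open_cbox[OF \<Omega>] by (metis Pow_iff subset_eq)
  have "AE x in lebesgue. x \<in> X \<longrightarrow> f x = 0" if "X \<in> D" for X
    using D(2)[OF that] AE_box by auto
  hence "\<forall>X\<in>D. AE x in lebesgue. x \<in> X \<longrightarrow> f x = 0" by blast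
  hence "AE x in lebesgue. \<forall>X\<in>D. x \<in> X \<longrightarrow> f x = 0"
    by (simp only: AE_ball_countable[OF D(1)])
  hence "AE x in lebesgue. x \<in> \<Omega> \<longrightarrow> g x = 0"
    by eventually_elim (metis D(3) UnionE f_def indicator_simps(1) mult_1)
  thus ?thesis using \<Omega>' by (simp add: AE_restrict_space_iff)
qed

section \<open>Weak gradients of finite element functions\<close>

text \<open>By translation invariance the difference quotients of \<open>F\<close> integrate to zero.\<close>

lemma integral_directional_derivative_eq_0:
  fixes F D :: "'a::euclidean_space \<Rightarrow> real" and e :: 'a
  assumes cont: "continuous_on UNIV F"
    and supp: "\<And>x. norm x > R \<Longrightarrow> F x = 0"
    and lip: "\<And>x t. 0 \<le> t \<Longrightarrow> \<bar>F (x + t *\<^sub>R e) - F x\<bar> \<le> C * t"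
    and D: "D \<in> borel_measurable lebesgue"
    and deriv: "AE x in lebesgue. ((\<lambda>s. F (x + s *\<^sub>R e)) has_real_derivative D x) (at 0)"
  shows "integral\<^sup>L lebesgue D = 0"
proof -
  \<comment> \<open>Any null sequence in \<open>(0, 1]\<close> would do; the bound 1 confines the
    supports of all quotients to a single ball.\<close>
  define h where "h n = inverse (real (Suc n))" for n
  have h: "0 < h n" "h n \<le> 1" for n by (simp_all add: h_def inverse_le_1_iff)
  have h0: "h \<longlonglongrightarrow> 0" unfolding h_def by (rule LIMSEQ_inverse_real_of_nat)
  define Q where "Q n x = (F (x + h n *\<^sub>R e) - F x) / h n" for n x
  have F_borel: "F \<in> borel_measurable lborel" using cont by (simp add: borel_measurable_continuous_onI)
  have F_int: "integrable lborel F"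
  proof -
    have "integrable lborel (\<lambda>x. indicator (cball 0 R) x *\<^sub>R F x)"
      by (rule borel_integrable_compact[OF compact_cball continuous_on_subset[OF cont subset_UNIV]])
    also have "(\<lambda>x. indicator (cball 0 R) x *\<^sub>R F x) = F"
      using supp by (auto simp: fun_eq_iff indicator_def)
    finally show ?thesis .
  qed
  have Q_int: "integral\<^sup>L lebesgue (Q n) = 0" for n
  proof -
    have F_shift: "integrable lborel (\<lambda>x. F (h n *\<^sub>R e + x))"
      "integral\<^sup>L lborel (\<lambda>x. F (h n *\<^sub>R e + x)) = integral\<^sup>L lborel F"
      using F_int integrable_distr_eq[of "(+) (h n *\<^sub>R e)" lborel borel F]
        integral_distr[of "(+) (h n *\<^sub>R e)" lborel borel F] F_borel
      by (simp_all add: lborel_distr_plus)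
    have "Q n \<in> borel_measurable lborel"
      unfolding Q_def by (simp, intro borel_measurable_continuous_onI continuous_intros
        continuous_on_compose2[OF cont]) (use h(1)[of n] in auto)
    hence "integral\<^sup>L lebesgue (Q n) = integral\<^sup>L lborel (Q n)" by (rule integral_completion)
    also have "\<dots> = 0" using F_shift F_int unfolding Q_def by (simp add: add.commute)
    finally show ?thesis .
  qed
  have "(\<lambda>n. integral\<^sup>L lebesgue (Q n)) \<longlonglongrightarrow> integral\<^sup>L lebesgue D"
  \<comment> \<open>The Lipschitz bound makes each quotient at most \<open>C\<close>. Outside radius
    \<open>R + norm e\<close> both \<open>x\<close> and its shift lie beyond \<open>R\<close>, so
    the quotient is zero there.\<close>
  proof (rule integral_dominated_convergence[where w = "\<lambda>x. C * indicator (cball 0 (R + norm e)) x"])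
    show "D \<in> borel_measurable lebesgue" by fact
    show "Q n \<in> borel_measurable lebesgue" for n
      unfolding Q_def by (intro measurable_completion, simp, intro borel_measurable_continuous_onI
        continuous_intros continuous_on_compose2[OF cont]) (use h(1)[of n] in auto)
    show "integrable lebesgue (\<lambda>x. C * indicator (cball (0::'a) (R + norm e)) x :: real)"
      using emeasure_bounded_finite[of "cball (0::'a) (R + norm e)"]
      by (intro integrable_mult_right integrable_real_indicator) auto
    show "AE x in lebesgue. (\<lambda>n. Q n x) \<longlonglongrightarrow> D x"
      using deriv
    proof eventually_elim
      fix x assume "((\<lambda>s. F (x + s *\<^sub>R e)) has_real_derivative D x) (at 0)"
      hence "((\<lambda>s. (F (x + s *\<^sub>R e) - F x) / s) \<longlongrightarrow> D x) (at 0)" by (simp add: DERIV_def)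
      moreover have "filterlim h (at 0) sequentially"
        using h(1) h0 by (auto simp: filterlim_at intro!: always_eventually less_imp_neq[symmetric])
      ultimately show "(\<lambda>n. Q n x) \<longlonglongrightarrow> D x"
        unfolding Q_def by (rule filterlim_compose)
    qed
    show "AE x in lebesgue. norm (Q n x) \<le> C * indicator (cball 0 (R + norm e)) x" for n
    proof (rule AE_I2)
      fix x
      show "norm (Q n x) \<le> C * indicator (cball 0 (R + norm e)) x"
      proof (cases "x \<in> cball 0 (R + norm e)")
        case True
        thus ?thesis using lip[of "h n" x] h(1)[of n] by (simp add: Q_def divide_le_eq)
      next
        case False
        have he: "norm (h n *\<^sub>R e) \<le> norm e" using h[of n] by (simp add: mult_left_le_one_le)
        have tri: "norm x \<le> norm (x + h n *\<^sub>R e) + norm (h n *\<^sub>R e)"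
          by (metis add_diff_cancel_right' norm_triangle_ineq4)
        have "norm x > R + norm e" using False by simp
        hence "norm (x + h n *\<^sub>R e) > R" "norm x > R"
          using he tri norm_ge_zero[of e] by linarith+
        thus ?thesis using False by (simp add: Q_def supp)
      qed
    qed
  qed
  thus ?thesis by (simp add: Q_int LIMSEQ_const_iff)
qed

lemma partial_deriv_zero_off_closed:
  assumes "closed S" and zero: "\<And>y. y \<notin> S \<Longrightarrow> f y = 0" and "x \<notin> S"
  shows "partial_deriv j f x = 0"
proof -
  have "(f has_derivative (\<lambda>h. 0)) (at x)"
    by (rule has_derivative_transform_within_open[of "\<lambda>x. 0" _ x UNIV "- S"])
      (use assms in auto)
  thus ?thesis by (simp add: partial_deriv_eqI)
qed

lemma test_function_bounds:
  assumes "\<phi> \<in> test_functions \<Omega>"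
  obtains B where "\<And>x. \<bar>\<phi> x\<bar> \<le> B" "\<And>x. \<bar>partial_deriv j \<phi> x\<bar> \<le> B"
proof -
  let ?S = "closure {x. \<phi> x \<noteq> 0}"
  have \<phi>: "compact ?S" "C1 \<phi>" using assms by (auto simp: test_functions_def C1_def)
  have off: "\<phi> x = 0" "partial_deriv j \<phi> x = 0" if x: "x \<notin> ?S" for x
  proof -
    show "\<phi> x = 0" using x closure_subset[of "{x. \<phi> x \<noteq> 0}"] by blast
    show "partial_deriv j \<phi> x = 0"
      by (rule partial_deriv_zero_off_closed[OF closed_closure _ x])
        (use closure_subset[of "{x. \<phi> x \<noteq> 0}"] in blast)
  qed
  have "continuous_on UNIV (partial_deriv j \<phi>)" using \<phi>(2) by (simp add: C1_def)
  hence "compact (\<phi> ` ?S)" "compact (partial_deriv j \<phi> ` ?S)"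
    using \<phi> C1_continuous by (auto intro!: compact_continuous_image intro: continuous_on_subset)
  hence "bounded (\<phi> ` ?S)" "bounded (partial_deriv j \<phi> ` ?S)" by (simp_all add: compact_imp_bounded)
  then obtain B1 B2 where B: "\<forall>y\<in>\<phi> ` ?S. norm y \<le> B1" "\<forall>y\<in>partial_deriv j \<phi> ` ?S. norm y \<le> B2"
    unfolding bounded_iff by blast
  show ?thesis
  \<comment> \<open>The 0 covers the points off the support, where no sign of \<open>B1\<close> and
    \<open>B2\<close> is known.\<close>
  proof (rule that[of "max 0 (max B1 B2)"])
    fix x
    have "\<bar>\<phi> x\<bar> \<le> B1 \<and> \<bar>partial_deriv j \<phi> x\<bar> \<le> B2" if "x \<in> ?S" using B that by auto
    thus "\<bar>\<phi> x\<bar> \<le> max 0 (max B1 B2)" "\<bar>partial_deriv j \<phi> x\<bar> \<le> max 0 (max B1 B2)"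
      using off[of x] by (cases "x \<in> ?S"; auto)+
  qed
qed

lemma has_real_derivative_along_line:
  fixes f :: "'a::real_normed_vector \<Rightarrow> real"
  assumes "(f has_derivative f') (at (x + s *\<^sub>R e))"
  shows "((\<lambda>s. f (x + s *\<^sub>R e)) has_real_derivative f' e) (at s)"
proof -
  interpret f': bounded_linear f' using assms by (rule has_derivative_bounded_linear)
  have "((\<lambda>s. x + s *\<^sub>R e) has_derivative (\<lambda>h. h *\<^sub>R e)) (at s)"
    by (auto intro!: derivative_eq_intros)
  hence "((\<lambda>s. f (x + s *\<^sub>R e)) has_derivative (\<lambda>h. f' (h *\<^sub>R e))) (at s)"
    using assms by (rule has_derivative_compose)
  moreover have "(\<lambda>h. f' (h *\<^sub>R e)) = (*) (f' e)" by (simp add: fun_eq_iff f'.scaleR)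
  ultimately show ?thesis by (simp add: has_field_derivative_def)
qed

context tetrahedral_mesh
begin

section \<open>The elementwise gradient and its integration by parts\<close>

definition skeleton :: "(real^3) set" where
  "skeleton = (\<Union>K\<in>\<T>. frontier K)"

definition interiors :: "(real^3) set" where
  "interiors = (\<Union>K\<in>\<T>. interior K)"

text \<open>Boundaries of convex sets are negligible, and there are finitely many elements.\<close>

lemma AE_not_skeleton: "AE x in lebesgue. x \<notin> skeleton"
proof -
  have "negligible skeleton" unfolding skeleton_def
    using finite_mesh by (intro negligible_Union) (auto intro: negligible_convex_frontier convex_element)
  thus ?thesis by (intro AE_not_in) (simp add: negligible_iff_null_sets)
qed

lemma not_skeleton: "x \<notin> skeleton \<Longrightarrow> x \<in> interiors \<or> x \<notin> closure \<Omega>"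
  unfolding skeleton_def interiors_def Union_mesh[symmetric] frontier_def by (auto simp: closed_element)

text \<open>A face that meets the interior of an element is the whole element. A common interior
  point would thus make the intersection equal to both elements.\<close>

lemma disjoint_interiors:
  assumes "K \<in> \<T>" "K' \<in> \<T>" "K \<noteq> K'"
  shows "interior K \<inter> interior K' = {}"
proof (rule ccontr)
  assume "interior K \<inter> interior K' \<noteq> {}"
  then obtain x where x: "x \<in> interior K" "x \<in> interior K'" by blast
  hence "x \<in> K \<inter> K'" using interior_subset by blast
  hence "K \<inter> K' = K" "K' \<inter> K = K'"
    using x face_of_disjoint_interior[OF face] assms by (metis IntI Int_commute empty_iff)+
  thus False using assms(3) by blast
qed

text \<open>Disjointness of the interiors lets such a function be written as a finite sum of
  constants times indicators of open sets; both claims are read off from this sum.\<close>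

lemma
  fixes G :: "real^3 \<Rightarrow> 'b::euclidean_space"
  assumes const: "\<And>K. K \<in> \<T> \<Longrightarrow> \<exists>A. \<forall>x\<in>interior K. G x = A"
    and zero: "\<And>x. x \<notin> interiors \<Longrightarrow> G x = 0"
  shows piecewise_constant_measurable: "G \<in> borel_measurable lebesgue"
    and piecewise_constant_bounded: "\<exists>B. \<forall>x. norm (G x) \<le> B"
proof -
  obtain A where A: "\<And>K x. K \<in> \<T> \<Longrightarrow> x \<in> interior K \<Longrightarrow> G x = A K" using const by metis
  have G: "G = (\<lambda>x. \<Sum>K\<in>\<T>. indicator (interior K) x *\<^sub>R A K)"
  proof
    fix x
    show "G x = (\<Sum>K\<in>\<T>. indicator (interior K) x *\<^sub>R A K)"
    proof (cases "x \<in> interiors")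
      case True
      then obtain K where K: "K \<in> \<T>" "x \<in> interior K" by (auto simp: interiors_def)
      hence "indicator (interior K') x *\<^sub>R A K' = (if K' = K then A K else 0)" if "K' \<in> \<T>" for K'
        using disjoint_interiors[of K K'] that by (auto simp: indicator_def)
      hence "(\<Sum>K\<in>\<T>. indicator (interior K) x *\<^sub>R A K) = (\<Sum>K'\<in>\<T>. if K' = K then A K else 0)"
        by (intro sum.cong) auto
      also have "\<dots> = A K" using finite_mesh K(1) by simp
      finally show ?thesis using A K by simp
    next
      case False
      thus ?thesis using zero by (auto simp: interiors_def indicator_def)
    qed
  qed
  show "G \<in> borel_measurable lebesgue"
    unfolding G by (intro borel_measurable_sum borel_measurable_scaleR borel_measurable_indicator
      borel_measurable_const) auto
  have "norm (G x) \<le> (\<Sum>K\<in>\<T>. norm (A K))" for x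
    unfolding G by (rule sum_norm_le) (simp add: indicator_def)
  thus "\<exists>B. \<forall>x. norm (G x) \<le> B" by blast
qed

lemma S1_has_derivative:
  assumes "f \<in> S1 \<Omega> \<T>" "K \<in> \<T>"
  obtains a where "\<And>x. x \<in> interior K \<Longrightarrow> (f has_derivative (\<lambda>h. a \<bullet> h)) (at x)"
proof -
  obtain a b where ab: "\<forall>x\<in>K. f x = a \<bullet> x + b" using assms unfolding S1_def by blast
  have "(f has_derivative (\<lambda>h. a \<bullet> h)) (at x)" if x: "x \<in> interior K" for x
  proof (rule has_derivative_transform_within_open[of "\<lambda>x. a \<bullet> x + b" _ x UNIV "interior K"])
    show "((\<lambda>x. a \<bullet> x + b) has_derivative (\<lambda>h. a \<bullet> h)) (at x)"
      by (auto intro!: derivative_eq_intros)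
  qed (use x ab interior_subset[of K] in auto)
  thus ?thesis using that by blast
qed

text \<open>The value 0 off the element interiors replaces the unspecified result of
  \<open>frechet_derivative\<close> at kinks, so that \<open>grad w\<close> is a genuine piecewise
  constant function on the whole space.\<close>

definition grad :: "(real^3 \<Rightarrow> real^3) \<Rightarrow> real^3 \<Rightarrow> real^3^3" where
  "grad w x = (\<chi> i j. if x \<in> interiors then partial_deriv j (\<lambda>y. w y $ i) x else 0)"

lemma
  assumes w: "w \<in> S1_vec \<Omega> \<T>"
  shows grad_measurable: "grad w \<in> borel_measurable lebesgue"
    and grad_bounded: "\<exists>B. \<forall>x. norm (grad w x) \<le> B"
proof -
  have "\<exists>A. \<forall>x\<in>interior K. grad w x = A" if K: "K \<in> \<T>" for K
  proof -
    have "\<exists>a. \<forall>x\<in>interior K. \<forall>j. partial_deriv j (\<lambda>y. w y $ i) x = a $ j" for i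
    proof -
      have "(\<lambda>y. w y $ i) \<in> S1 \<Omega> \<T>" using w by (simp add: S1_vec_def)
      then obtain a where "\<And>x. x \<in> interior K \<Longrightarrow> ((\<lambda>y. w y $ i) has_derivative (\<lambda>h. a \<bullet> h)) (at x)"
        using S1_has_derivative K by blast
      thus ?thesis using partial_deriv_eqI by (intro exI[of _ a]) (fastforce simp: inner_axis)
    qed
    then obtain a where "\<And>i x j. x \<in> interior K \<Longrightarrow> partial_deriv j (\<lambda>y. w y $ i) x = a i $ j"
      by metis
    hence "\<forall>x\<in>interior K. grad w x = (\<chi> i j. a i $ j)"
      using K by (auto simp: grad_def interiors_def vec_eq_iff)
    thus ?thesis by blast
  qed
  moreover have "grad w x = 0" if "x \<notin> interiors" for x
    using that by (simp add: grad_def vec_eq_iff)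
  ultimately show "grad w \<in> borel_measurable lebesgue" "\<exists>B. \<forall>x. norm (grad w x) \<le> B"
    using piecewise_constant_measurable piecewise_constant_bounded by blast+
qed

text \<open>\<open>\<Omega>\<close> need not be convex, so \<open>f\<close> itself need not be Lipschitz on \<open>\<Omega>\<close>.  The product is: on a line, the
  elements and the complement of \<open>\<Omega>\<close> form a finite closed cover, and it is Lipschitz on each piece.\<close>

lemma S1_mult_test_lipschitz:
  assumes f: "f \<in> S1 \<Omega> \<T>" and \<phi>: "\<phi> \<in> test_functions \<Omega>"
  obtains C where "\<And>x t. 0 \<le> t \<Longrightarrow>
    \<bar>f (x + t *\<^sub>R axis j 1) * \<phi> (x + t *\<^sub>R axis j 1) - f x * \<phi> x\<bar> \<le> C * t"
proof -
  let ?e = "axis j 1 :: real^3"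
  obtain Bf where Bf: "Bf > 0" "\<And>x. \<bar>f x\<bar> \<le> Bf" using S1_bounded[OF f] by blast
  obtain B where B: "\<And>x. \<bar>\<phi> x\<bar> \<le> B" "\<And>x. \<bar>partial_deriv j \<phi> x\<bar> \<le> B"
    using test_function_bounds[OF \<phi>] by blast
  have B0: "B \<ge> 0" using B(1)[of 0] by linarith
  have "\<exists>a b. \<forall>x\<in>K. f x = a \<bullet> x + b" if "K \<in> \<T>" for K
    using f that by (auto simp: S1_def)
  then obtain a b where ab: "\<And>K x. K \<in> \<T> \<Longrightarrow> x \<in> K \<Longrightarrow> f x = a K \<bullet> x + b K" by metis
  define A where "A = (\<Sum>K\<in>\<T>. norm (a K))"
  have A: "norm (a K) \<le> A" if "K \<in> \<T>" for K
    unfolding A_def using finite_mesh that by (intro member_le_sum) auto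
  have A0: "A \<ge> 0" unfolding A_def by (intro sum_nonneg) auto
  \<comment> \<open>The product rule in Lipschitz form: \<open>f\<close> is bounded by
    \<open>Bf\<close> and \<phi> has slope at most \<open>B\<close>; \<phi> is bounded by
    \<open>B\<close> and \<open>f\<close> has slope at most \<open>A\<close> on each
    element.\<close>
  define C where "C = Bf * B + B * A"
  have C0: "C \<ge> 0" using Bf(1) B0 A0 by (simp add: C_def)
  have C1\<phi>: "C1 \<phi>" using \<phi> by (simp add: test_functions_def C1_def)
  have \<phi>_lip: "\<bar>\<phi> (x + s *\<^sub>R ?e) - \<phi> (x + t *\<^sub>R ?e)\<bar> \<le> B * \<bar>s - t\<bar>" for x s t
  proof -
    have "((\<lambda>s. \<phi> (x + s *\<^sub>R ?e)) has_real_derivative partial_deriv j \<phi> (x + s *\<^sub>R ?e)) (at s)" for s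
      unfolding partial_deriv_def by (rule has_real_derivative_along_line[OF C1_has_derivative[OF C1\<phi>]])
    from field_differentiable_bound[of UNIV "\<lambda>s. \<phi> (x + s *\<^sub>R ?e)"
        "\<lambda>s. partial_deriv j \<phi> (x + s *\<^sub>R ?e)" B s t] this B(2)
    show ?thesis by (simp add: real_norm_def)
  qed
  have "\<bar>f (x + t *\<^sub>R ?e) * \<phi> (x + t *\<^sub>R ?e) - f x * \<phi> x\<bar> \<le> C * t" if t: "0 \<le> t" for x t
  proof -
    let ?g = "\<lambda>s. f (x + s *\<^sub>R ?e) * \<phi> (x + s *\<^sub>R ?e)"
    let ?U = "\<lambda>X. {s::real. x + s *\<^sub>R ?e \<in> X}"
    have "C-lipschitz_on {0..t} ?g"
    proof (rule lipschitz_on_closed_Union[where I = "insert (- \<Omega>) \<T>" and U = ?U])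
      fix X assume X: "X \<in> insert (- \<Omega>) \<T>"
      hence "closed X" using open_domain closed_element by auto
      thus "closed (?U X)"
        using closed_vimage[of X "\<lambda>s. x + s *\<^sub>R ?e"] by (simp add: continuous_intros vimage_def)
      show "C-lipschitz_on (?U X) ?g"
      proof (rule lipschitz_onI[OF _ C0])
        fix s s' assume s: "s \<in> ?U X" "s' \<in> ?U X"
        show "dist (?g s) (?g s') \<le> C * dist s s'"
        proof (cases "X \<in> \<T>")
          case True
          let ?y = "x + s *\<^sub>R ?e" and ?y' = "x + s' *\<^sub>R ?e"
          have "f ?y - f ?y' = (s - s') * (a X \<bullet> ?e)"
            using ab[OF True] s by (simp add: inner_simps algebra_simps)
          moreover have "\<bar>a X \<bullet> ?e\<bar> \<le> A"
            using Cauchy_Schwarz_ineq2[of "a X" ?e] A[OF True] by simp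
          ultimately have 1: "\<bar>f ?y - f ?y'\<bar> \<le> A * \<bar>s - s'\<bar>"
            by (simp only: abs_mult) (subst mult.commute, rule mult_right_mono, auto)
          have "\<bar>p * u - q * v\<bar> \<le> \<bar>p\<bar> * \<bar>u - v\<bar> + \<bar>v\<bar> * \<bar>p - q\<bar>" for p q u v :: real
            using abs_triangle_ineq[of "p * (u - v)" "v * (p - q)"]
            by (simp add: abs_mult[symmetric] algebra_simps)
          hence "\<bar>?g s - ?g s'\<bar> \<le> \<bar>f ?y\<bar> * \<bar>\<phi> ?y - \<phi> ?y'\<bar> + \<bar>\<phi> ?y'\<bar> * \<bar>f ?y - f ?y'\<bar>" .
          also have "\<dots> \<le> Bf * (B * \<bar>s - s'\<bar>) + B * (A * \<bar>s - s'\<bar>)"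
            using Bf B0 B(1) 1 \<phi>_lip by (intro add_mono mult_mono) auto
          finally show ?thesis by (simp add: C_def dist_real_def algebra_simps)
        next
          \<comment> \<open>Here \<open>X\<close> is the complement of \<open>\<Omega>\<close>. The
            zero extension of \<open>f\<close> may jump at the boundary, but \<phi> vanishes on all
            of \<open>X\<close>.\<close>
          case False
          hence "y \<notin> \<Omega>" if "y \<in> X" for y using X that by auto
          moreover have "\<phi> y = 0" if "y \<notin> \<Omega>" for y
            using \<phi> that closure_subset[of "{x. \<phi> x \<noteq> 0}"] by (auto simp: test_functions_def)
          ultimately have g0: "?g s = 0" "?g s' = 0" using s by auto
          show ?thesis unfolding g0 using C0 by (simp add: mult_nonneg_nonneg)
        qed
      qed
    next
      have "\<Omega> \<subseteq> \<Union>\<T>" by (simp add: Union_mesh closure_subset)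
      thus "{0..t} \<subseteq> (\<Union>X\<in>insert (- \<Omega>) \<T>. ?U X)" by auto
    qed (use finite_mesh C0 in auto)
    from lipschitz_onD[OF this, of t 0] t show ?thesis by (simp add: dist_real_def)
  qed
  thus ?thesis using that by blast
qed

text \<open>The domain and the complement of the support of \<phi> are open and cover the space. The
  product is continuous on the former and zero on the latter, so the jump of the zero extension of
  \<open>f\<close> is never seen.\<close>

lemma S1_mult_test_continuous:
  assumes f: "f \<in> S1 \<Omega> \<T>" and \<phi>: "\<phi> \<in> test_functions \<Omega>"
  shows "continuous_on UNIV (\<lambda>x. f x * \<phi> x)"
proof -
  obtain S where S: "closed S" "S \<subseteq> \<Omega>" "\<And>x. x \<notin> S \<Longrightarrow> \<phi> x = 0"
  proof
    show "closure {x. \<phi> x \<noteq> 0} \<subseteq> \<Omega>" using \<phi> by (simp add: test_functions_def)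
    show "\<phi> x = 0" if "x \<notin> closure {x. \<phi> x \<noteq> 0}" for x
      using that closure_subset[of "{x. \<phi> x \<noteq> 0}"] by blast
  qed simp
  have "C1 \<phi>" using \<phi> by (simp add: test_functions_def C1_def)
  have "continuous_on \<Omega> f" using f closure_subset by (auto simp: S1_def intro: continuous_on_subset)
  hence "continuous_on \<Omega> (\<lambda>x. f x * \<phi> x)"
    using continuous_on_subset[OF C1_continuous[OF \<open>C1 \<phi>\<close>] subset_UNIV] by (rule continuous_on_mult)
  moreover have "continuous_on (- S) (\<lambda>x. f x * \<phi> x)"
    by (rule continuous_on_eq[of _ "\<lambda>x. 0"]) (use S(3) in auto)
  ultimately have "continuous_on (\<Omega> \<union> - S) (\<lambda>x. f x * \<phi> x)"
    using open_domain S(1) by (intro continuous_on_open_Un) auto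
  moreover have "\<Omega> \<union> - S = UNIV" using S(2) by auto
  ultimately show ?thesis by simp
qed

lemma test_function_zero_outside:
  assumes \<phi>: "\<phi> \<in> test_functions \<Omega>" and x: "x \<notin> \<Omega>"
  shows "\<phi> x = 0" "partial_deriv j \<phi> x = 0"
proof -
  have x: "x \<notin> closure {x. \<phi> x \<noteq> 0}" using \<phi> x by (auto simp: test_functions_def)
  thus "\<phi> x = 0" using closure_subset[of "{x. \<phi> x \<noteq> 0}"] by blast
  show "partial_deriv j \<phi> x = 0"
    by (rule partial_deriv_zero_off_closed[OF closed_closure _ x])
      (use closure_subset[of "{x. \<phi> x \<noteq> 0}"] in blast)
qed

text \<open>The product of \<open>f\<close> and \<phi> is continuous, compactly supported and
  Lipschitz in direction \<open>j\<close>, so its derivative in that direction has integral zero. No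
  interface or boundary terms arise.\<close>

lemma integration_by_parts:
  assumes w: "w \<in> S1_vec \<Omega> \<T>" and \<phi>: "\<phi> \<in> test_functions \<Omega>"
  shows "(LINT x|lebesgue_on \<Omega>. w x $ i * partial_deriv j \<phi> x)
       = - (LINT x|lebesgue_on \<Omega>. grad w x $ i $ j * \<phi> x)"
proof -
  let ?e = "axis j 1 :: real^3"
  define f where "f = (\<lambda>x. w x $ i)"
  have f: "f \<in> S1 \<Omega> \<T>" using w by (simp add: S1_vec_def f_def)
  have C1\<phi>: "C1 \<phi>" using \<phi> by (simp add: test_functions_def C1_def)
  have comp: "grad w x $ i $ j = (if x \<in> interiors then partial_deriv j f x else 0)" for x
    by (simp add: grad_def f_def)
  obtain B where B: "\<And>x. \<bar>\<phi> x\<bar> \<le> B" "\<And>x. \<bar>partial_deriv j \<phi> x\<bar> \<le> B"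
    using test_function_bounds[OF \<phi>] by blast
  obtain Bf where Bf: "Bf > 0" "\<And>x. \<bar>f x\<bar> \<le> Bf" using S1_bounded[OF f] by blast
  obtain Bg where Bg: "\<And>x. norm (grad w x) \<le> Bg" using grad_bounded[OF w] by blast
  have Bg': "\<bar>grad w x $ i $ j\<bar> \<le> Bg" for x
    using Bg[of x] component_le_norm_cart[of "grad w x $ i" j] Finite_Cartesian_Product.norm_nth_le[of "grad w x" i] by linarith
  have cont: "continuous_on UNIV \<phi>" "continuous_on UNIV (partial_deriv j \<phi>)"
    using C1\<phi> C1_continuous by (auto simp: C1_def)
  have meas: "\<phi> \<in> borel_measurable (lebesgue_on \<Omega>)" "partial_deriv j \<phi> \<in> borel_measurable (lebesgue_on \<Omega>)"
    using cont open_domain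
    by (auto intro!: continuous_imp_measurable_on_sets_lebesgue intro: continuous_on_subset)
  have grad_ij: "(\<lambda>x. grad w x $ i $ j) \<in> borel_measurable lebesgue"
  proof -
    have "(\<lambda>x. grad w x \<bullet> axis i (axis j 1)) \<in> borel_measurable lebesgue"
      by (intro borel_measurable_inner grad_measurable[OF w] borel_measurable_const)
    thus ?thesis by (simp add: inner_axis)
  qed
  have f_int: "integrable (lebesgue_on \<Omega>) (\<lambda>x. f x * partial_deriv j \<phi> x)"
    by (rule integrable_bounded_domain[where B = "Bf * B"])
      (use S1_measurable[OF f] meas Bf B in \<open>auto simp: abs_mult intro!: mult_mono\<close>)
  have grad_int: "integrable (lebesgue_on \<Omega>) (\<lambda>x. grad w x $ i $ j * \<phi> x)"
    by (rule integrable_bounded_domain[where B = "Bg * B"])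
      (use measurable_restrict_space1[OF grad_ij] meas Bg' B order_trans[OF abs_ge_zero Bg']
        in \<open>auto simp: abs_mult intro!: mult_mono\<close>)
  \<comment> \<open>This is the derivative of the product almost everywhere. It vanishes off
    \<open>\<Omega>\<close>, so its integrals over \<open>\<Omega>\<close> and over the whole space
    coincide.\<close>
  define D where "D x = f x * partial_deriv j \<phi> x + grad w x $ i $ j * \<phi> x" for x
  have D_off: "D x = 0" if "x \<notin> \<Omega>" for x
    using test_function_zero_outside[OF \<phi> that] by (simp add: D_def)
  have intD: "integrable (lebesgue_on \<Omega>) D" unfolding D_def using f_int grad_int by simp
  have D_eq: "(\<lambda>x. indicator \<Omega> x *\<^sub>R D x) = D" using D_off by (fastforce simp: indicator_def)
  have sets: "\<Omega> \<inter> space lebesgue \<in> sets lebesgue" using open_domain by simp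
  have "integral\<^sup>L lebesgue D = 0"
  proof -
    obtain C where C: "\<And>x t. 0 \<le> t \<Longrightarrow>
        \<bar>f (x + t *\<^sub>R ?e) * \<phi> (x + t *\<^sub>R ?e) - f x * \<phi> x\<bar> \<le> C * t"
      using S1_mult_test_lipschitz[OF f \<phi>] by blast
    obtain R where R: "\<And>x. x \<in> \<Omega> \<Longrightarrow> norm x \<le> R"
      using bounded_domain by (auto simp: bounded_iff)
    show ?thesis
    proof (rule integral_directional_derivative_eq_0[OF S1_mult_test_continuous[OF f \<phi>] _ C])
      show "f x * \<phi> x = 0" if "norm x > R" for x
        using test_function_zero_outside(1)[OF \<phi>, of x] R[of x] that by auto
      show "D \<in> borel_measurable lebesgue"
        using intD D_eq borel_measurable_restrict_space_iff[OF sets, of D] by auto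
      show "AE x in lebesgue. ((\<lambda>s. f (x + s *\<^sub>R ?e) * \<phi> (x + s *\<^sub>R ?e)) has_real_derivative D x) (at 0)"
        \<comment> \<open>Off the skeleton a point is either interior to an element, where
          \<open>f\<close> is affine, or outside the closed domain, where the product is locally
          zero.\<close>
        using AE_not_skeleton
      proof eventually_elim
        fix x assume "x \<notin> skeleton"
        then consider "x \<in> interiors" | "x \<notin> closure \<Omega>" using not_skeleton by blast
        thus "((\<lambda>s. f (x + s *\<^sub>R ?e) * \<phi> (x + s *\<^sub>R ?e)) has_real_derivative D x) (at 0)"
        proof cases
          case 1
          then obtain K where K: "K \<in> \<T>" "x \<in> interior K" by (auto simp: interiors_def)
          obtain a where a: "(f has_derivative (\<lambda>h. a \<bullet> h)) (at x)"
            using S1_has_derivative[OF f K(1)] K(2) by blast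
          have "((\<lambda>x. f x * \<phi> x) has_derivative
              (\<lambda>h. f x * frechet_derivative \<phi> (at x) h + (a \<bullet> h) * \<phi> x)) (at (x + 0 *\<^sub>R ?e))"
            using has_derivative_mult[OF a C1_has_derivative[OF C1\<phi>]] by simp
          from has_real_derivative_along_line[OF this] show ?thesis
            using 1 partial_deriv_eqI[OF a] by (simp add: D_def comp partial_deriv_def)
        next
          case 2
          have "((\<lambda>x. f x * \<phi> x) has_derivative (\<lambda>h. 0)) (at (x + 0 *\<^sub>R ?e))"
            by (rule has_derivative_transform_within_open[of "\<lambda>x. 0" _ _ UNIV "- closure \<Omega>"])
              (use 2 f in \<open>auto simp: S1_def\<close>)
          from has_real_derivative_along_line[OF this] have "((\<lambda>s. f (x + s *\<^sub>R ?e) * \<phi> (x + s *\<^sub>R ?e)) has_real_derivative 0) (at 0)" .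
          moreover have "x \<notin> \<Omega>" using 2 closure_subset by blast
          ultimately show ?thesis using D_off by simp
        qed
      qed
    qed
  qed
  hence "integral\<^sup>L (lebesgue_on \<Omega>) D = 0"
    by (simp only: integral_restrict_space[OF sets] D_eq)
  hence "(LINT x|lebesgue_on \<Omega>. f x * partial_deriv j \<phi> x)
      + (LINT x|lebesgue_on \<Omega>. grad w x $ i $ j * \<phi> x) = 0"
    unfolding D_def using f_int grad_int by simp
  thus ?thesis by (simp add: f_def)
qed

lemma is_weak_gradient_grad:
  assumes w: "w \<in> S1_vec \<Omega> \<T>"
  shows "is_weak_gradient \<Omega> w (grad w)"
proof -
  obtain B where B: "\<And>x. norm (grad w x) \<le> B" using grad_bounded[OF w] by blast
  have m: "grad w \<in> borel_measurable (lebesgue_on \<Omega>)"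
    using grad_measurable[OF w] by (rule measurable_restrict_space1)
  have "integrable (lebesgue_on \<Omega>) (\<lambda>x. (norm (grad w x))\<^sup>2)"
    by (rule integrable_bounded_domain[where B = "B\<^sup>2"])
      (use m B in \<open>auto intro!: power_mono borel_measurable_power borel_measurable_norm\<close>)
  thus ?thesis using m integration_by_parts[OF w] by (simp add: is_weak_gradient_def L2_space_def)
qed

text \<open>Square integrability implies integrability on a set of finite measure, through
  \<open>t \<le> 1 + t^2\<close> for \<open>t \<ge> 0\<close>. The fundamental lemma asks for
  integrable functions only.\<close>

lemma weak_gradient_component_integrable:
  assumes "is_weak_gradient \<Omega> w G"
  shows "integrable (lebesgue_on \<Omega>) (\<lambda>x. G x $ i $ j)"
proof (rule Bochner_Integration.integrable_bound)
  have G: "G \<in> borel_measurable (lebesgue_on \<Omega>)" "integrable (lebesgue_on \<Omega>) (\<lambda>x. (norm (G x))\<^sup>2)"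
    using assms by (auto simp: is_weak_gradient_def L2_space_def)
  show "integrable (lebesgue_on \<Omega>) (\<lambda>x. 1 + (norm (G x))\<^sup>2)"
    by (rule Bochner_Integration.integrable_add[OF finite_measure.integrable_const[OF finite_measure_domain] G(2)])
  have "(\<lambda>x. G x \<bullet> axis i (axis j 1)) \<in> borel_measurable (lebesgue_on \<Omega>)"
    by (intro borel_measurable_inner G borel_measurable_const)
  thus "(\<lambda>x. G x $ i $ j) \<in> borel_measurable (lebesgue_on \<Omega>)" by (simp add: inner_axis)
  have "\<bar>G x $ i $ j\<bar> \<le> 1 + (norm (G x))\<^sup>2" for x
  proof -
    have "\<bar>G x $ i $ j\<bar> \<le> norm (G x)"
      using component_le_norm_cart[of "G x $ i" j] Finite_Cartesian_Product.norm_nth_le[of "G x" i] by linarith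
    also have "\<dots> \<le> 1 + (norm (G x))\<^sup>2"
      using zero_le_power2[of "norm (G x) - 1"] norm_ge_zero[of "G x"]
      unfolding power2_diff power_one by linarith
    finally show ?thesis .
  qed
  thus "AE x in lebesgue_on \<Omega>. norm (G x $ i $ j) \<le> norm (1 + (norm (G x))\<^sup>2)"
    by (intro AE_I2) (simp add: add_nonneg_nonneg)
qed

text \<open>Both defining identities have the same left-hand side, so every entry of the difference
  is orthogonal to all test functions.\<close>

lemma weak_gradient_unique:
  assumes G: "is_weak_gradient \<Omega> w G" and H: "is_weak_gradient \<Omega> w H"
  shows "AE x in lebesgue_on \<Omega>. G x = H x"
proof -
  have "AE x in lebesgue_on \<Omega>. G x $ i $ j - H x $ i $ j = 0" for i j
  proof (rule fundamental_lemma_calculus_of_variations[OF open_domain])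
    note int = weak_gradient_component_integrable[OF G, of i j] weak_gradient_component_integrable[OF H, of i j]
    show "integrable (lebesgue_on \<Omega>) (\<lambda>x. G x $ i $ j - H x $ i $ j)" using int by simp
    fix \<phi> assume \<phi>: "\<phi> \<in> test_functions \<Omega>"
    obtain B where B: "\<And>x. \<bar>\<phi> x\<bar> \<le> B" using test_function_bounds[OF \<phi>] by blast
    have "continuous_on \<Omega> \<phi>"
      using \<phi> C1_continuous[of \<phi>] by (auto simp: test_functions_def C1_def intro: continuous_on_subset)
    hence m: "\<phi> \<in> borel_measurable (lebesgue_on \<Omega>)"
      using open_domain by (intro continuous_imp_measurable_on_sets_lebesgue) auto
    have "integrable (lebesgue_on \<Omega>) (\<lambda>x. g x * \<phi> x)" if "integrable (lebesgue_on \<Omega>) g" for g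
    proof (rule Bochner_Integration.integrable_bound[where f = "\<lambda>x. B * g x"])
      show "integrable (lebesgue_on \<Omega>) (\<lambda>x. B * g x)" using that by simp
      show "(\<lambda>x. g x * \<phi> x) \<in> borel_measurable (lebesgue_on \<Omega>)"
        using that m by (intro borel_measurable_times) auto
      have "\<bar>g x * \<phi> x\<bar> \<le> \<bar>B * g x\<bar>" for x
        using mult_right_mono[OF order_trans[OF B[of x] abs_ge_self], of "\<bar>g x\<bar>"]
        by (simp add: abs_mult mult.commute)
      thus "AE x in lebesgue_on \<Omega>. norm (g x * \<phi> x) \<le> norm (B * g x)" by simp
    qed
    from this[OF int(1)] this[OF int(2)]
    have "(LINT x|lebesgue_on \<Omega>. (G x $ i $ j - H x $ i $ j) * \<phi> x)
        = (LINT x|lebesgue_on \<Omega>. G x $ i $ j * \<phi> x) - (LINT x|lebesgue_on \<Omega>. H x $ i $ j * \<phi> x)"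
      by (simp add: left_diff_distrib)
    also have "\<dots> = 0"
    proof -
      have "(LINT x|lebesgue_on \<Omega>. w x $ i * partial_deriv j \<phi> x)
          = - (LINT x|lebesgue_on \<Omega>. G' x $ i $ j * \<phi> x)" if "is_weak_gradient \<Omega> w G'" for G'
        using that \<phi> unfolding is_weak_gradient_def by blast
      from this[OF G] this[OF H] show ?thesis by linarith
    qed
    finally show "(LINT x|lebesgue_on \<Omega>. (G x $ i $ j - H x $ i $ j) * \<phi> x) = 0" .
  qed
  hence "AE x in lebesgue_on \<Omega>. \<forall>i j. G x $ i $ j - H x $ i $ j = 0"
    unfolding AE_all_countable by blast
  thus ?thesis by eventually_elim (simp add: vec_eq_iff)
qed

text \<open>Since \<open>grad w\<close> is a weak gradient, the \<open>SOME\<close> is not void, and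
  whichever one it returns agrees with \<open>grad w\<close> up to a null set, which integrals do
  not see.\<close>

lemma weak_gradient_S1:
  assumes "w \<in> S1_vec \<Omega> \<T>"
  shows "AE x in lebesgue_on \<Omega>. weak_gradient \<Omega> w x = grad w x"
proof (rule weak_gradient_unique)
  show "is_weak_gradient \<Omega> w (weak_gradient \<Omega> w)"
    unfolding weak_gradient_def using is_weak_gradient_grad[OF assms] by (rule someI[of "is_weak_gradient \<Omega> w"])
qed (rule is_weak_gradient_grad[OF assms])

end

section \<open>The discrete Laplacian\<close>

context tetrahedral_mesh
begin

lemma S1_vec_comp: "w \<in> S1_vec \<Omega> \<T> \<Longrightarrow> (\<lambda>x. w x $ i) \<in> S1 \<Omega> \<T>"
  by (simp add: S1_vec_def)

lemma S1_vec_lincomb: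
  "u \<in> S1_vec \<Omega> \<T> \<Longrightarrow> w \<in> S1_vec \<Omega> \<T> \<Longrightarrow> (\<lambda>x. s *\<^sub>R u x + t *\<^sub>R w x) \<in> S1_vec \<Omega> \<T>"
  by (simp add: S1_vec_def S1_lincomb)

lemma S1_vec_zero: "(\<lambda>x. 0) \<in> S1_vec \<Omega> \<T>"
  by (simp add: S1_vec_def S1_zero)

lemma S1_vec_sum:
  assumes "finite Q" "\<And>q. q \<in> Q \<Longrightarrow> h q \<in> S1_vec \<Omega> \<T>"
  shows "(\<lambda>x. \<Sum>q\<in>Q. c q *\<^sub>R h q x) \<in> S1_vec \<Omega> \<T>"
  using assms
proof (induction Q rule: finite_induct)
  case empty
  show ?case by (simp add: S1_vec_zero)
next
  case (insert q Q)
  thus ?case using S1_vec_lincomb[of "h q" "\<lambda>x. \<Sum>q\<in>Q. c q *\<^sub>R h q x" "c q" 1] by simp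
qed

lemma S1_vec_eqI:
  assumes "u \<in> S1_vec \<Omega> \<T>" "w \<in> S1_vec \<Omega> \<T>" "\<And>z. z \<in> N \<Longrightarrow> u z = w z"
  shows "u = w"
proof
  fix x
  have "(\<lambda>x. u x $ i) = (\<lambda>x. w x $ i)" for i
    by (rule S1_eqI) (use assms S1_vec_comp in auto)
  thus "u x = w x" by (metis vec_eq_iff)
qed

lemma vector_nodal_interpolation:
  fixes c :: "real^3 \<Rightarrow> real^3"
  obtains w where "w \<in> S1_vec \<Omega> \<T>" "\<And>z. z \<in> N \<Longrightarrow> w z = c z"
proof -
  have "\<exists>f. f \<in> S1 \<Omega> \<T> \<and> (\<forall>z\<in>N. f z = c z $ i)" for i
    using nodal_interpolation[of "\<lambda>z. c z $ i"] by metis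
  then obtain f where f: "\<And>i. f i \<in> S1 \<Omega> \<T>" "\<And>i z. z \<in> N \<Longrightarrow> f i z = c z $ i" by metis
  show ?thesis
    by (rule that[of "\<lambda>x. \<chi> i. f i x"]) (use f in \<open>auto simp: S1_vec_def vec_eq_iff\<close>)
qed

section \<open>Vectorial hat functions and testing in the mass-lumped product\<close>

definition hat :: "(real^3) \<times> 3 \<Rightarrow> real^3 \<Rightarrow> real^3" where
  "hat q x = nodal_basis \<Omega> \<T> (fst q) x *\<^sub>R axis (snd q) 1"

abbreviation "DoF \<equiv> N \<times> (UNIV :: 3 set)"

lemma finite_DoF: "finite DoF"
  using finite_vertices by simp

lemma hat_in_S1_vec:
  assumes "q \<in> DoF"
  shows "hat q \<in> S1_vec \<Omega> \<T>"
proof -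
  have "nodal_basis \<Omega> \<T> (fst q) \<in> S1 \<Omega> \<T>" using assms by (auto intro: nodal_basis_in_S1)
  from S1_lincomb[OF this S1_zero, of "axis (snd q) 1 $ i" 0 for i] show ?thesis
    by (simp add: S1_vec_def hat_def mult.commute)
qed

lemma hat_vertex: "q \<in> DoF \<Longrightarrow> z \<in> N \<Longrightarrow> hat q z = (if z = fst q then axis (snd q) 1 else 0)"
  by (auto simp: hat_def nodal_basis_vertex)

lemma hat_sum_vertex:
  assumes z: "z \<in> N"
  shows "(\<Sum>q\<in>DoF. x q *\<^sub>R hat q z) = (\<chi> i. x (z, i))"
proof -
  have "(\<Sum>q\<in>DoF. x q *\<^sub>R hat q z) = (\<Sum>z'\<in>N. \<Sum>i\<in>UNIV. x (z', i) *\<^sub>R hat (z', i) z)"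
    by (simp add: sum.cartesian_product)
  also have "\<dots> = (\<Sum>z'\<in>N. if z' = z then \<Sum>i\<in>UNIV. x (z, i) *\<^sub>R axis i 1 else 0)"
    by (rule sum.cong) (auto simp: hat_vertex z)
  also have "\<dots> = (\<Sum>i\<in>UNIV. x (z, i) *\<^sub>R axis i 1)" using finite_vertices z by simp
  also have "\<dots> = (\<chi> i. x (z, i))"
    by (simp add: vec_eq_iff axis_def if_distrib cong: if_cong)
  finally show ?thesis .
qed

lemma hat_expansion:
  assumes w: "w \<in> S1_vec \<Omega> \<T>"
  shows "w = (\<lambda>x. \<Sum>q\<in>DoF. (w (fst q) $ snd q) *\<^sub>R hat q x)"
  by (rule S1_vec_eqI[OF w S1_vec_sum[OF finite_DoF hat_in_S1_vec]])
    (simp_all add: hat_sum_vertex vec_eq_iff)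

lemma mass_lumped_lincomb_left:
  "mass_lumped \<Omega> \<T> (\<lambda>x. s *\<^sub>R u x + t *\<^sub>R u' x) w
     = s * mass_lumped \<Omega> \<T> u w + t * mass_lumped \<Omega> \<T> u' w"
  by (simp add: mass_lumped_def inner_simps sum.distrib sum_distrib_left algebra_simps)

lemma mass_lumped_hat:
  assumes q: "q \<in> DoF"
  shows "mass_lumped \<Omega> \<T> u (hat q) = lumping_weight \<Omega> \<T> (fst q) * u (fst q) $ snd q"
proof -
  have "mass_lumped \<Omega> \<T> u (hat q)
      = (\<Sum>z\<in>N. if z = fst q then lumping_weight \<Omega> \<T> (fst q) * u (fst q) $ snd q else 0)"
    unfolding mass_lumped_def by (rule sum.cong) (auto simp: hat_vertex q inner_axis)
  also have "\<dots> = lumping_weight \<Omega> \<T> (fst q) * u (fst q) $ snd q"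
    using finite_vertices q by (auto simp: mem_Times_iff)
  finally show ?thesis .
qed

lemma mass_lumped_cong:
  assumes "\<And>z. z \<in> N \<Longrightarrow> u z = u' z"
  shows "mass_lumped \<Omega> \<T> u w = mass_lumped \<Omega> \<T> u' w"
  unfolding mass_lumped_def by (rule sum.cong) (simp_all add: assms)

text \<open>A hat function extracts one component at one vertex, times a positive weight. No
  membership in the space is asked of \<open>u\<close> and \<open>u'\<close>: cross products of
  nodal functions are generally not piecewise affine and enter through their vertex values
  only.\<close>

lemma mass_lumped_test:
  "(\<forall>w\<in>S1_vec \<Omega> \<T>. mass_lumped \<Omega> \<T> u w = mass_lumped \<Omega> \<T> u' w) \<longleftrightarrow> (\<forall>z\<in>N. u z = u' z)"
proof (intro iffI ballI)
  fix z assume *: "\<forall>w\<in>S1_vec \<Omega> \<T>. mass_lumped \<Omega> \<T> u w = mass_lumped \<Omega> \<T> u' w" and z: "z \<in> N"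
  have "u z $ i = u' z $ i" for i
    using * hat_in_S1_vec[of "(z, i)"] mass_lumped_hat[of "(z, i)"] lumping_weight_pos[OF z] z by auto
  thus "u z = u' z" by (simp add: vec_eq_iff)
qed (rule mass_lumped_cong, blast)

text \<open>The Dirichlet form written with the explicit representative \<open>grad\<close>, for
  which bilinearity can be computed, unlike for the chosen weak gradient.\<close>

definition energy :: "(real^3 \<Rightarrow> real^3) \<Rightarrow> (real^3 \<Rightarrow> real^3) \<Rightarrow> real" where
  "energy u w = (LINT x|lebesgue_on \<Omega>. grad u x \<bullet> grad w x)"

lemma grad_measurable_on:
  "w \<in> S1_vec \<Omega> \<T> \<Longrightarrow> grad w \<in> borel_measurable (lebesgue_on \<Omega>)"
  using grad_measurable by (rule measurable_restrict_space1)

lemma L2_product_weak_gradient: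
  assumes u: "u \<in> S1_vec \<Omega> \<T>" and w: "w \<in> S1_vec \<Omega> \<T>"
  shows "L2_product \<Omega> (weak_gradient \<Omega> u) (weak_gradient \<Omega> w) = energy u w"
proof -
  have meas: "weak_gradient \<Omega> v \<in> borel_measurable (lebesgue_on \<Omega>)" if "v \<in> S1_vec \<Omega> \<T>" for v
  proof -
    have "is_weak_gradient \<Omega> v (weak_gradient \<Omega> v)"
      unfolding weak_gradient_def using is_weak_gradient_grad[OF that] by (rule someI[of "is_weak_gradient \<Omega> v"])
    thus ?thesis by (simp add: is_weak_gradient_def L2_space_def)
  qed
  have "AE x in lebesgue_on \<Omega>. weak_gradient \<Omega> u x \<bullet> weak_gradient \<Omega> w x = grad u x \<bullet> grad w x"
    using weak_gradient_S1[OF u] weak_gradient_S1[OF w] by eventually_elim simp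
  thus ?thesis unfolding L2_product_def energy_def
    by (intro integral_cong_AE borel_measurable_inner meas grad_measurable_on u w)
qed

lemma energy_integrable:
  assumes u: "u \<in> S1_vec \<Omega> \<T>" and w: "w \<in> S1_vec \<Omega> \<T>"
  shows "integrable (lebesgue_on \<Omega>) (\<lambda>x. grad u x \<bullet> grad w x)"
proof -
  obtain B where B: "\<And>x. norm (grad u x) \<le> B" using grad_bounded[OF u] by blast
  obtain C where C: "\<And>x. norm (grad w x) \<le> C" using grad_bounded[OF w] by blast
  show ?thesis
  proof (rule integrable_bounded_domain[where B = "B * C"])
    show "(\<lambda>x. grad u x \<bullet> grad w x) \<in> borel_measurable (lebesgue_on \<Omega>)"
      by (intro borel_measurable_inner grad_measurable_on u w)
    show "norm (grad u x \<bullet> grad w x) \<le> B * C" for x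
    proof -
      have "norm (grad u x \<bullet> grad w x) \<le> norm (grad u x) * norm (grad w x)"
        using Cauchy_Schwarz_ineq2 by simp
      also have "\<dots> \<le> B * C"
        using B C order_trans[OF norm_ge_zero B] by (intro mult_mono) auto
      finally show ?thesis .
    qed
  qed
qed

lemma grad_lincomb:
  assumes u: "u \<in> S1_vec \<Omega> \<T>" and w: "w \<in> S1_vec \<Omega> \<T>"
  shows "grad (\<lambda>x. s *\<^sub>R u x + t *\<^sub>R w x) x = s *\<^sub>R grad u x + t *\<^sub>R grad w x"
proof (cases "x \<in> interiors")
  case True
  then obtain K where K: "K \<in> \<T>" "x \<in> interior K" by (auto simp: interiors_def)
  have "partial_deriv j (\<lambda>y. (s *\<^sub>R u y + t *\<^sub>R w y) $ i) x
      = s * partial_deriv j (\<lambda>y. u y $ i) x + t * partial_deriv j (\<lambda>y. w y $ i) x" for i j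
  proof -
    obtain a where a: "((\<lambda>y. u y $ i) has_derivative (\<lambda>h. a \<bullet> h)) (at x)"
      using S1_has_derivative[OF S1_vec_comp[OF u] K(1)] K(2) by blast
    obtain b where b: "((\<lambda>y. w y $ i) has_derivative (\<lambda>h. b \<bullet> h)) (at x)"
      using S1_has_derivative[OF S1_vec_comp[OF w] K(1)] K(2) by blast
    have "((\<lambda>y. s * u y $ i + t * w y $ i) has_derivative (\<lambda>h. s * (a \<bullet> h) + t * (b \<bullet> h))) (at x)"
      by (intro has_derivative_add has_derivative_mult_right a b)
    from partial_deriv_eqI[OF this] show ?thesis
      by (simp add: partial_deriv_eqI[OF a] partial_deriv_eqI[OF b])
  qed
  thus ?thesis using True by (simp add: grad_def vec_eq_iff)
qed (simp add: grad_def vec_eq_iff)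

lemma energy_commute: "energy u w = energy w u"
  by (simp add: energy_def inner_commute)

lemma energy_lincomb_right:
  assumes "v \<in> S1_vec \<Omega> \<T>" "u \<in> S1_vec \<Omega> \<T>" "w \<in> S1_vec \<Omega> \<T>"
  shows "energy v (\<lambda>x. s *\<^sub>R u x + t *\<^sub>R w x) = s * energy v u + t * energy v w"
  using energy_integrable[OF assms(1,2)] energy_integrable[OF assms(1,3)]
  by (simp add: energy_def grad_lincomb assms inner_simps)

lemma energy_sum_right:
  assumes "v \<in> S1_vec \<Omega> \<T>" "finite Q" "\<And>q. q \<in> Q \<Longrightarrow> h q \<in> S1_vec \<Omega> \<T>"
  shows "energy v (\<lambda>x. \<Sum>q\<in>Q. c q *\<^sub>R h q x) = (\<Sum>q\<in>Q. c q * energy v (h q))"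
  using assms(2,3)
proof (induction Q rule: finite_induct)
  case empty
  show ?case using energy_lincomb_right[OF assms(1) S1_vec_zero S1_vec_zero, of 0 0] by simp
next
  case (insert q Q)
  thus ?case
    using energy_lincomb_right[OF assms(1), of "h q" "\<lambda>x. \<Sum>q\<in>Q. c q *\<^sub>R h q x" "c q" 1] S1_vec_sum[of Q h c]
    by simp
qed

lemma energy_nonneg: "0 \<le> energy u u"
  unfolding energy_def by (rule integral_nonneg_AE) simp

text \<open>Zero energy forces the gradient to vanish almost everywhere. Since constants have this
  property too, the usable conclusion is orthogonality to every \<open>w\<close>, not that
  \<open>u\<close> is zero.\<close>

lemma energy_eq_0:
  assumes u: "u \<in> S1_vec \<Omega> \<T>" and "energy u u = 0"
  shows "energy u w = 0"
proof -
  have "AE x in lebesgue_on \<Omega>. grad u x \<bullet> grad u x = 0"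
    using assms integral_nonneg_eq_0_iff_AE[OF energy_integrable[OF u u]] by (simp add: energy_def)
  hence "AE x in lebesgue_on \<Omega>. grad u x \<bullet> grad w x = 0" by eventually_elim simp
  thus ?thesis unfolding energy_def by (rule integral_eq_zero_AE)
qed

abbreviation "lap \<equiv> discrete_laplacian \<Omega> \<T>"

text \<open>These facts show that the \<open>THE\<close> in \<open>discrete_laplacian\<close> is
  well-defined: \<open>mass_lumped_test\<close> gives uniqueness, and existence is explicit because
  lumping makes the mass matrix diagonal.\<close>

lemma
  assumes u: "u \<in> S1_vec \<Omega> \<T>"
  shows lap_in_S1_vec: "lap u \<in> S1_vec \<Omega> \<T>"
    and lap_energy: "\<And>w. w \<in> S1_vec \<Omega> \<T> \<Longrightarrow> mass_lumped \<Omega> \<T> (lap u) w = - energy u w"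
    and lap_eqI: "\<And>D. D \<in> S1_vec \<Omega> \<T> \<Longrightarrow>
      (\<And>w. w \<in> S1_vec \<Omega> \<T> \<Longrightarrow> mass_lumped \<Omega> \<T> D w = - energy u w) \<Longrightarrow> lap u = D"
proof -
  let ?P = "\<lambda>D. D \<in> S1_vec \<Omega> \<T> \<and> (\<forall>w\<in>S1_vec \<Omega> \<T>.
    - mass_lumped \<Omega> \<T> D w = L2_product \<Omega> (weak_gradient \<Omega> u) (weak_gradient \<Omega> w))"
  have P: "?P D \<longleftrightarrow> D \<in> S1_vec \<Omega> \<T> \<and> (\<forall>w\<in>S1_vec \<Omega> \<T>. mass_lumped \<Omega> \<T> D w = - energy u w)" for D
    using L2_product_weak_gradient[OF u] by force
  have unique: "D = D'" if "?P D" "?P D'" for D D'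
  proof (rule S1_vec_eqI)
    show "D z = D' z" if "z \<in> N" for z
      using mass_lumped_test[of D D'] \<open>?P D\<close> \<open>?P D'\<close> that unfolding P by metis
  qed (use that in auto)
  \<comment> \<open>Testing with a single hat function dictates each nodal component: minus the
    energy pairing divided by the weight. Expansion in hats then gives the identity for every
    \<open>w\<close>.\<close>
  obtain D where D: "D \<in> S1_vec \<Omega> \<T>"
    "\<And>z. z \<in> N \<Longrightarrow> D z = (\<chi> i. - energy u (hat (z, i)) / lumping_weight \<Omega> \<T> z)"
    using vector_nodal_interpolation[of "\<lambda>z. \<chi> i. - energy u (hat (z, i)) / lumping_weight \<Omega> \<T> z"] by blast
  have "mass_lumped \<Omega> \<T> D w = - energy u w" if w: "w \<in> S1_vec \<Omega> \<T>" for w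
  proof -
    have "mass_lumped \<Omega> \<T> D w = (\<Sum>z\<in>N. \<Sum>i\<in>UNIV. - (w z $ i * energy u (hat (z, i))))"
      unfolding mass_lumped_def
    proof (rule sum.cong[OF refl])
      fix z assume z: "z \<in> N"
      hence "lumping_weight \<Omega> \<T> z \<noteq> 0" using lumping_weight_pos by force
      thus "lumping_weight \<Omega> \<T> z * (D z \<bullet> w z) = (\<Sum>i\<in>UNIV. - (w z $ i * energy u (hat (z, i))))"
        by (simp add: D(2)[OF z] inner_vec_def sum_distrib_left mult.commute)
    qed
    also have "\<dots> = - (\<Sum>q\<in>DoF. (w (fst q) $ snd q) * energy u (hat q))"
      by (simp add: sum.cartesian_product sum_negf case_prod_unfold)
    also have "(\<Sum>q\<in>DoF. (w (fst q) $ snd q) * energy u (hat q))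
        = energy u (\<lambda>x. \<Sum>q\<in>DoF. (w (fst q) $ snd q) *\<^sub>R hat q x)"
      by (rule energy_sum_right[OF u finite_DoF hat_in_S1_vec, symmetric])
    also have "\<dots> = energy u w" using hat_expansion[OF w] by simp
    finally show ?thesis .
  qed
  hence PD: "?P D" using D(1) unfolding P by blast
  have "lap u = D" unfolding discrete_laplacian_def by (rule the_equality) (use PD unique in blast)+
  hence Pl: "?P (lap u)" using PD by simp
  thus "lap u \<in> S1_vec \<Omega> \<T>" "\<And>w. w \<in> S1_vec \<Omega> \<T> \<Longrightarrow> mass_lumped \<Omega> \<T> (lap u) w = - energy u w"
    unfolding P by blast+
  fix D' assume "D' \<in> S1_vec \<Omega> \<T>" "\<And>w. w \<in> S1_vec \<Omega> \<T> \<Longrightarrow> mass_lumped \<Omega> \<T> D' w = - energy u w"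
  hence "?P D'" unfolding P by blast
  thus "lap u = D'" using unique Pl by blast
qed

text \<open>The right-hand side solves the variational problem that characterises the left-hand
  side.\<close>

lemma lap_lincomb:
  assumes "u \<in> S1_vec \<Omega> \<T>" "w \<in> S1_vec \<Omega> \<T>"
  shows "lap (\<lambda>x. s *\<^sub>R u x + t *\<^sub>R w x) = (\<lambda>x. s *\<^sub>R lap u x + t *\<^sub>R lap w x)"
proof (rule lap_eqI[OF S1_vec_lincomb[OF assms] S1_vec_lincomb[OF lap_in_S1_vec lap_in_S1_vec, OF assms]])
  fix v assume v: "v \<in> S1_vec \<Omega> \<T>"
  show "mass_lumped \<Omega> \<T> (\<lambda>x. s *\<^sub>R lap u x + t *\<^sub>R lap w x) v
      = - energy (\<lambda>x. s *\<^sub>R u x + t *\<^sub>R w x) v"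
    using energy_lincomb_right[OF v assms] lap_energy[OF assms(1) v] lap_energy[OF assms(2) v]
    by (simp add: mass_lumped_lincomb_left energy_commute[of _ v])
qed

end

section \<open>Well-posedness\<close>

text \<open>Injectivity implies surjectivity for a square system, by Gaussian elimination on one
  unknown \<open>p\<close> at a time. Rows and columns are indexed by arbitrary finite sets, so that
  pairs of a vertex and a component can serve as indices.\<close>

lemma linear_system_solvable:
  fixes a :: "'r \<Rightarrow> 'c \<Rightarrow> 'f::field"
  assumes "finite C" "finite R" "card R = card C"
    and "\<And>x. (\<And>i. i \<in> R \<Longrightarrow> (\<Sum>j\<in>C. a i j * x j) = 0) \<Longrightarrow> (\<And>j. j \<in> C \<Longrightarrow> x j = 0)"
  shows "\<exists>x. \<forall>i\<in>R. (\<Sum>j\<in>C. a i j * x j) = b i"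
  using assms
proof (induction C arbitrary: R a b rule: finite_induct)
  case empty
  thus ?case by simp
next
  case (insert p C)
  \<comment> \<open>A pivot exists: if column \<open>p\<close> were zero, the unit vector at
    \<open>p\<close> would be in the kernel.\<close>
  have "\<exists>q\<in>R. a q p \<noteq> 0"
  proof (rule ccontr)
    assume "\<not> (\<exists>q\<in>R. a q p \<noteq> 0)"
    hence "(\<Sum>j\<in>insert p C. a i j * (if j = p then 1 else 0)) = 0" if "i \<in> R" for i
      using that by (intro sum.neutral) auto
    from insert.prems(3)[OF this, of p] show False by simp
  qed
  then obtain q where q: "q \<in> R" "a q p \<noteq> 0" by blast
  define a' where "a' i j = a i j - a i p / a q p * a q j" for i j
  define b' where "b' i = b i - a i p / a q p * b q" for i
  \<comment> \<open>Back substitution: the value at \<open>p\<close> is chosen so that row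
    \<open>q\<close> evaluates to \<open>r\<close>. Kernel vectors of the reduced system are
    extended with \<open>r = 0\<close>, solutions with \<open>r = b q\<close>.\<close>
  define ext where "ext r x j = (if j = p then (r - (\<Sum>j\<in>C. a q j * x j)) / a q p else x j)" for r x j
  have row: "(\<Sum>j\<in>insert p C. a i j * ext r x j) = a i p / a q p * r + (\<Sum>j\<in>C. a' i j * x j)"
    for i r x
  proof -
    have "(\<Sum>j\<in>C. a i j * ext r x j) = (\<Sum>j\<in>C. a i j * x j)"
      using insert.hyps by (intro sum.cong) (auto simp: ext_def)
    hence lhs: "(\<Sum>j\<in>insert p C. a i j * ext r x j)
        = a i p * ((r - (\<Sum>j\<in>C. a q j * x j)) / a q p) + (\<Sum>j\<in>C. a i j * x j)"
      using insert.hyps by (simp add: ext_def)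
    have rhs: "(\<Sum>j\<in>C. a' i j * x j) = (\<Sum>j\<in>C. a i j * x j) - a i p / a q p * (\<Sum>j\<in>C. a q j * x j)"
      by (simp add: a'_def left_diff_distrib sum_subtractf sum_distrib_left mult.assoc)
    show ?thesis unfolding lhs rhs by (simp add: diff_divide_distrib right_diff_distrib)
  qed
  have a'q: "a' q j = 0" for j using q by (simp add: a'_def)
  have "\<exists>x. \<forall>i\<in>R - {q}. (\<Sum>j\<in>C. a' i j * x j) = b' i"
  proof (rule insert.IH)
    show "finite (R - {q})" using insert by simp
    show "card (R - {q}) = card C" using insert q by simp
    fix x j
    assume *: "\<And>i. i \<in> R - {q} \<Longrightarrow> (\<Sum>j\<in>C. a' i j * x j) = 0" and j: "j \<in> C"
    have "(\<Sum>j\<in>insert p C. a i j * ext 0 x j) = 0" if "i \<in> R" for i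
      using *[of i] that by (cases "i = q") (simp_all add: row a'q)
    hence "ext 0 x j = 0" using insert.prems(3) j by blast
    thus "x j = 0" using j insert.hyps by (auto simp: ext_def split: if_splits)
  qed
  then obtain x where x: "\<And>i. i \<in> R - {q} \<Longrightarrow> (\<Sum>j\<in>C. a' i j * x j) = b' i" by blast
  have "(\<Sum>j\<in>insert p C. a i j * ext (b q) x j) = b i" if "i \<in> R" for i
    using x[of i] that q by (cases "i = q") (simp_all add: row a'q b'_def)
  thus ?case by blast
qed

section \<open>Cross product algebra and the vertex equation of the corrector\<close>

lemma dot_cross3_triple: "y \<bullet> cross3 x (cross3 x y) = - (norm (cross3 x y))\<^sup>2"
  by (simp add: power2_norm_eq_inner) (simp add: cross3_simps)

lemma cross3_lincomb_right:
  "cross3 x (s *\<^sub>R y + t *\<^sub>R y') = s *\<^sub>R cross3 x y + t *\<^sub>R cross3 x y'"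
  by (simp add: cross3_simps)

lemma implicit_midpoint_step_unique:
  fixes a m :: "real^3"
  assumes "c > 0"
  shows "\<exists>!y. c *\<^sub>R (y - m) = - cross3 ((y + m) /\<^sub>R 2) a"
proof -
  \<comment> \<open>Collects the terms in the new value \<open>y\<close>; those in \<open>m\<close>
    go to the right-hand side. Then \<open>y \<bullet> f y = c * (y \<bullet> y)\<close>, and an
    injective endomorphism of a finite-dimensional space is bijective.\<close>
  define f where "f y = c *\<^sub>R y + inverse 2 *\<^sub>R cross3 y a" for y
  have lin: "linear f"
    by (rule linearI) (simp_all add: f_def cross3_simps)
  have pos: "y \<bullet> f y = c * (y \<bullet> y)" for y
    by (simp add: f_def inner_simps dot_cross_self)
  have "inj f"
    unfolding linear_injective_0[OF lin] using pos assms by (metis inner_eq_zero_iff inner_zero_right mult_eq_0_iff less_irrefl)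
  hence "bij f" using linear_injective_imp_surjective[OF lin] by (simp add: bij_def)
  hence "\<exists>!y. f y = c *\<^sub>R m - inverse 2 *\<^sub>R cross3 m a" by (simp only: bij_iff)
  moreover have "f y = c *\<^sub>R m - inverse 2 *\<^sub>R cross3 m a \<longleftrightarrow>
      c *\<^sub>R (y - m) = - cross3 ((y + m) /\<^sub>R 2) a" for y
    by (subst (1 2) right_minus_eq[symmetric])
      (simp add: f_def cross_add_left cross_mult_left algebra_simps)
  ultimately show ?thesis by simp
qed

context tetrahedral_mesh
begin

lemma dissipative_system_injective:
  fixes A :: "real^3 \<Rightarrow> real^3 \<Rightarrow> real^3"
  assumes "c > 0" "\<kappa> \<ge> 0" and dissip: "\<And>z y. y \<bullet> A z y \<le> 0" and A0: "\<And>z. A z 0 = 0"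
    and v: "v \<in> S1_vec \<Omega> \<T>" and eq: "\<And>z. z \<in> N \<Longrightarrow> c *\<^sub>R v z + \<kappa> *\<^sub>R A z (lap v z) = 0"
    and z: "z \<in> N"
  shows "v z = 0"
proof -
  let ?\<beta> = "lumping_weight \<Omega> \<T>"
  have "0 = (\<Sum>z\<in>N. ?\<beta> z * (lap v z \<bullet> (c *\<^sub>R v z + \<kappa> *\<^sub>R A z (lap v z))))"
    by (simp add: eq)
  \<comment> \<open>The pairing with \<open>lap v\<close> turns the first term into minus the energy
    and leaves \<open>A\<close> tested against its own argument.\<close>
  also have "\<dots> = c * mass_lumped \<Omega> \<T> (lap v) v + \<kappa> * (\<Sum>z\<in>N. ?\<beta> z * (lap v z \<bullet> A z (lap v z)))"
    by (simp add: mass_lumped_def inner_simps sum.distrib sum_distrib_left algebra_simps)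
  also have "mass_lumped \<Omega> \<T> (lap v) v = - energy v v" by (rule lap_energy[OF v v])
  finally have "c * energy v v = \<kappa> * (\<Sum>z\<in>N. ?\<beta> z * (lap v z \<bullet> A z (lap v z)))" by simp
  also have "\<dots> \<le> 0"
    using assms(2) dissip lumping_weight_pos
    by (intro mult_nonneg_nonpos sum_nonpos) (auto intro: less_imp_le)
  finally have "energy v v = 0"
    using assms(1) energy_nonneg[of v] by (simp add: mult_le_0_iff)
  hence "\<forall>w\<in>S1_vec \<Omega> \<T>. mass_lumped \<Omega> \<T> (lap v) w = mass_lumped \<Omega> \<T> (\<lambda>x. 0) w"
    using lap_energy[OF v] energy_eq_0[OF v] by (simp add: mass_lumped_def)
  hence "lap v z = 0" using z unfolding mass_lumped_test by blast
  thus ?thesis using eq[OF z] assms(1) A0 by simp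
qed

text \<open>The Laplacian couples the vertices, so the system cannot be solved vertex by vertex. It
  is written in the hat basis with rows and columns both indexed by \<open>DoF\<close>, and
  injectivity then yields existence as well as uniqueness.\<close>

lemma dissipative_system_unique_solution:
  fixes A :: "real^3 \<Rightarrow> real^3 \<Rightarrow> real^3"
  assumes "c > 0" "\<kappa> \<ge> 0" and dissip: "\<And>z y. y \<bullet> A z y \<le> 0" and lin: "\<And>z. linear (A z)"
  shows "\<exists>!v. v \<in> S1_vec \<Omega> \<T> \<and> (\<forall>z\<in>N. c *\<^sub>R v z + \<kappa> *\<^sub>R A z (lap v z) = b z)"
proof -
  define E where "E v z = c *\<^sub>R v z + \<kappa> *\<^sub>R A z (lap v z)" for v z
  have E_lincomb: "E (\<lambda>x. s *\<^sub>R u x + t *\<^sub>R w x) z = s *\<^sub>R E u z + t *\<^sub>R E w z"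
    if "u \<in> S1_vec \<Omega> \<T>" "w \<in> S1_vec \<Omega> \<T>" for s t u w z
    unfolding E_def lap_lincomb[OF that]
    by (simp add: linear_add[OF lin] linear_scale[OF lin] algebra_simps)
  have E_zero: "E (\<lambda>x. 0) z = 0" for z
    using E_lincomb[OF S1_vec_zero S1_vec_zero, of 0 0 z] by simp
  have E_sum: "E (\<lambda>y. \<Sum>q\<in>Q. x q *\<^sub>R hat q y) z = (\<Sum>q\<in>Q. x q *\<^sub>R E (hat q) z)"
    if "finite Q" "Q \<subseteq> DoF" for Q x z
    using that
  proof (induction Q rule: finite_induct)
    case (insert q Q)
    have "q \<in> DoF" "Q \<subseteq> DoF" using insert.prems by auto
    hence "hat q \<in> S1_vec \<Omega> \<T>" "(\<lambda>y. \<Sum>q\<in>Q. x q *\<^sub>R hat q y) \<in> S1_vec \<Omega> \<T>"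
      using hat_in_S1_vec insert.hyps by (auto intro!: S1_vec_sum simp del: mem_Sigma_iff)
    from E_lincomb[OF this, of "x q" 1 z] show ?case
      using insert \<open>Q \<subseteq> DoF\<close> by simp
  qed (simp add: E_zero)
  have inj: "v z = 0" if "v \<in> S1_vec \<Omega> \<T>" "\<And>z. z \<in> N \<Longrightarrow> E v z = 0" "z \<in> N" for v z
    using dissipative_system_injective[of c \<kappa> A v z] assms that linear_0[OF lin] by (simp add: E_def)
  \<comment> \<open>Column \<open>q\<close> holds the nodal components of the operator applied to
    the hat function of \<open>q\<close>.\<close>
  let ?a = "\<lambda>p q. E (hat q) (fst p) $ snd p"
  have E_x: "E (\<lambda>y. \<Sum>q\<in>DoF. x q *\<^sub>R hat q y) z $ i = (\<Sum>q\<in>DoF. ?a (z, i) q * x q)" for x z i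
    by (simp add: E_sum[OF finite_DoF subset_refl] mult.commute)
  have "\<exists>x. \<forall>p\<in>DoF. (\<Sum>q\<in>DoF. ?a p q * x q) = b (fst p) $ snd p"
  proof (rule linear_system_solvable[OF finite_DoF finite_DoF refl])
    fix x q assume x: "\<And>p. p \<in> DoF \<Longrightarrow> (\<Sum>q\<in>DoF. ?a p q * x q) = 0" and q: "q \<in> DoF"
    let ?v = "\<lambda>y. \<Sum>q\<in>DoF. x q *\<^sub>R hat q y"
    have "E ?v z = 0" if "z \<in> N" for z
      using x[of "(z, _)"] that by (simp add: vec_eq_iff E_x)
    hence "?v (fst q) = 0"
      using inj[of ?v "fst q"] S1_vec_sum[OF finite_DoF hat_in_S1_vec] q by (simp add: mem_Times_iff)
    moreover have "fst q \<in> N" using q by auto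
    ultimately have "(\<chi> i. x (fst q, i)) $ snd q = 0" by (simp add: hat_sum_vertex)
    thus "x q = 0" by simp
  qed
  then obtain x where x: "\<And>p. p \<in> DoF \<Longrightarrow> (\<Sum>q\<in>DoF. ?a p q * x q) = b (fst p) $ snd p" by blast
  let ?v = "\<lambda>y. \<Sum>q\<in>DoF. x q *\<^sub>R hat q y"
  have v: "?v \<in> S1_vec \<Omega> \<T>" by (rule S1_vec_sum[OF finite_DoF hat_in_S1_vec])
  have "E ?v z = b z" if "z \<in> N" for z
    using x[of "(z, _)"] that by (simp add: vec_eq_iff E_x)
  moreover have "u = w" if "u \<in> S1_vec \<Omega> \<T>" "w \<in> S1_vec \<Omega> \<T>"
    "\<And>z. z \<in> N \<Longrightarrow> E u z = b z" "\<And>z. z \<in> N \<Longrightarrow> E w z = b z" for u w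
  proof (rule S1_vec_eqI[OF that(1,2)])
    fix z assume z: "z \<in> N"
    have "(\<lambda>x. 1 *\<^sub>R u x + (-1) *\<^sub>R w x) z = 0"
      by (rule inj[OF S1_vec_lincomb[OF that(1,2)] _ z]) (simp only: E_lincomb[OF that(1,2)], simp add: that)
    thus "u z = w z" by simp
  qed
  ultimately show ?thesis using v unfolding E_def by blast
qed

lemma predictor_unique:
  assumes \<alpha>: "0 \<le> \<alpha>" and \<theta>k: "0 \<le> \<theta> * k" and m: "m \<in> S1_vec \<Omega> \<T>"
  shows "\<exists>!v. v \<in> S1_vec \<Omega> \<T> \<and> predictor_eq \<Omega> \<T> \<alpha> l_ex \<theta> k m v"
proof -
  \<comment> \<open>The precession part is orthogonal to \<open>y\<close>, and the damping part has
    a sign because \<open>\<alpha> \<ge> 0\<close>. The minus signs of the scheme are absorbed by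
    moving \<open>A\<close> to the left-hand side, with
    \<open>\<kappa> = \<theta> * k\<close>.\<close>
  define A where "A z y = l_ex\<^sup>2 *\<^sub>R cross3 (m z) y + (\<alpha> * l_ex\<^sup>2) *\<^sub>R cross3 (m z) (cross3 (m z) y)" for z y
  have A_lin: "linear (A z)" for z
    by (rule linearI) (simp_all add: A_def cross3_simps)
  have A_dissip: "y \<bullet> A z y \<le> 0" for z y
    using \<alpha> by (simp add: A_def inner_add_right dot_cross_self dot_cross3_triple)
  have nodewise: "predictor_eq \<Omega> \<T> \<alpha> l_ex \<theta> k m v \<longleftrightarrow>
      (\<forall>z\<in>N. (1 + \<alpha>\<^sup>2) *\<^sub>R v z + (\<theta> * k) *\<^sub>R A z (lap v z) = - A z (lap m z))"
    if v: "v \<in> S1_vec \<Omega> \<T>" for v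
  proof -
    let ?D = "lap (\<lambda>x. m x + (\<theta> * k) *\<^sub>R v x)"
    have D: "?D = (\<lambda>x. lap m x + (\<theta> * k) *\<^sub>R lap v x)"
      using lap_lincomb[OF m v, of 1 "\<theta> * k"] by simp
    \<comment> \<open>The dummy summand with factor 0 gives the left-hand side the shape of a linear
      combination, so that one rewrite rule pulls the scalars into both products.\<close>
    have "predictor_eq \<Omega> \<T> \<alpha> l_ex \<theta> k m v \<longleftrightarrow> (\<forall>w\<in>S1_vec \<Omega> \<T>.
        mass_lumped \<Omega> \<T> (\<lambda>x. (1 + \<alpha>\<^sup>2) *\<^sub>R v x + 0 *\<^sub>R v x) w
        = mass_lumped \<Omega> \<T> (\<lambda>x. (- l_ex\<^sup>2) *\<^sub>R cross3 (m x) (?D x)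
            + (- (\<alpha> * l_ex\<^sup>2)) *\<^sub>R cross3 (m x) (cross3 (m x) (?D x))) w)"
      unfolding predictor_eq_def Let_def mass_lumped_lincomb_left by simp
    also have "\<dots> \<longleftrightarrow> (\<forall>z\<in>N. (1 + \<alpha>\<^sup>2) *\<^sub>R v z = - A z (?D z))"
      unfolding mass_lumped_test by (simp add: A_def)
    also have "\<dots> \<longleftrightarrow> (\<forall>z\<in>N. (1 + \<alpha>\<^sup>2) *\<^sub>R v z + (\<theta> * k) *\<^sub>R A z (lap v z) = - A z (lap m z))"
      by (simp add: D linear_add[OF A_lin] linear_scale[OF A_lin] eq_neg_iff_add_eq_0 algebra_simps)
    finally show ?thesis .
  qed
  have "1 + \<alpha>\<^sup>2 > 0" by (simp add: add_pos_nonneg)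
  from dissipative_system_unique_solution[OF this \<theta>k A_dissip A_lin, where b = "\<lambda>z. - A z (lap m z)"]
  show ?thesis by (simp only: nodewise cong: conj_cong)
qed

lemma corrector_unique:
  assumes k: "k > 0"
  shows "\<exists>!m'. m' \<in> S1_vec \<Omega> \<T> \<and> corrector_eq \<Omega> \<T> \<alpha> l_ex k m v m'"
proof -
  define p where "p x = m x + (k / 2) *\<^sub>R v x" for x
  \<comment> \<open>The bracket of the corrector involves only the known \<open>p\<close>. Both
    cross products therefore share the left factor \<open>mid\<close> and merge into a single
    product with \<open>a\<close>, which makes the equation affine in the new iterate.\<close>
  define a where "a z = l_ex\<^sup>2 *\<^sub>R lap p z + (\<alpha> * l_ex\<^sup>2) *\<^sub>R cross3 (p z) (lap p z)" for z
  define c where "c = (1 + \<alpha>\<^sup>2) / k"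
  have c: "c > 0" using k by (simp add: c_def add_pos_nonneg)
  have eq: "corrector_eq \<Omega> \<T> \<alpha> l_ex k m v m' \<longleftrightarrow>
      (\<forall>z\<in>N. c *\<^sub>R (m' z - m z) = - cross3 ((m' z + m z) /\<^sub>R 2) (a z))" for m'
  proof -
    let ?mid = "\<lambda>x. (m' x + m x) /\<^sub>R 2"
    have "corrector_eq \<Omega> \<T> \<alpha> l_ex k m v m' \<longleftrightarrow> (\<forall>w\<in>S1_vec \<Omega> \<T>.
        mass_lumped \<Omega> \<T> (\<lambda>x. (1 + \<alpha>\<^sup>2) *\<^sub>R ((m' x - m x) /\<^sub>R k) + 0 *\<^sub>R m x) w
        = mass_lumped \<Omega> \<T> (\<lambda>x. (- l_ex\<^sup>2) *\<^sub>R cross3 (?mid x) (lap p x)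
            + (- (\<alpha> * l_ex\<^sup>2)) *\<^sub>R cross3 (?mid x) (cross3 (p x) (lap p x))) w)"
      unfolding corrector_eq_def Let_def p_def[symmetric] mass_lumped_lincomb_left by simp
    also have "\<dots> \<longleftrightarrow> (\<forall>z\<in>N. c *\<^sub>R (m' z - m z) = - cross3 ((m' z + m z) /\<^sub>R 2) (a z))"
    proof -
      have "(1 + \<alpha>\<^sup>2) *\<^sub>R ((m' z - m z) /\<^sub>R k) + 0 *\<^sub>R m z = c *\<^sub>R (m' z - m z)" for z
        by (simp add: c_def divide_inverse)
      moreover have "(- l_ex\<^sup>2) *\<^sub>R cross3 (?mid z) (lap p z)
            + (- (\<alpha> * l_ex\<^sup>2)) *\<^sub>R cross3 (?mid z) (cross3 (p z) (lap p z))
          = - cross3 (?mid z) (a z)" for z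
        unfolding a_def cross3_lincomb_right by simp
      ultimately show ?thesis unfolding mass_lumped_test by (simp only:)
    qed
    finally show ?thesis .
  qed
  \<comment> \<open>The vertex equation is solved at every point of space; interpolation keeps only
    the values at the vertices.\<close>
  obtain y where y: "\<And>z. c *\<^sub>R (y z - m z) = - cross3 ((y z + m z) /\<^sub>R 2) (a z)"
    using choice[OF allI[OF ex1_implies_ex[OF implicit_midpoint_step_unique[OF c]]], of m a] by blast
  obtain m' where m': "m' \<in> S1_vec \<Omega> \<T>" "\<And>z. z \<in> N \<Longrightarrow> m' z = y z"
    using vector_nodal_interpolation by blast
  show ?thesis
  proof (rule ex1I[of _ m'])
    show "m' \<in> S1_vec \<Omega> \<T> \<and> corrector_eq \<Omega> \<T> \<alpha> l_ex k m v m'" using m' y by (simp add: eq)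
    fix u assume "u \<in> S1_vec \<Omega> \<T> \<and> corrector_eq \<Omega> \<T> \<alpha> l_ex k m v u"
    hence u: "u \<in> S1_vec \<Omega> \<T>"
      "\<And>z. z \<in> N \<Longrightarrow> c *\<^sub>R (u z - m z) = - cross3 ((u z + m z) /\<^sub>R 2) (a z)"
      by (auto simp: eq)
    show "u = m'"
    proof (rule S1_vec_eqI[OF u(1) m'(1)])
      fix z assume z: "z \<in> N"
      have "u z = y z"
        using implicit_midpoint_step_unique[OF c, of "m z" "a z"] u(2)[OF z] y[of z] by blast
      thus "u z = m' z" using m'(2)[OF z] by simp
    qed
  qed
qed

end

theorem theorem4p5:
  fixes \<Omega> :: "(real^3) set" and \<T> :: "(real^3) set set"
    and T k \<alpha> l_ex \<theta> :: real and L :: nat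
  assumes "bounded_lipschitz_domain \<Omega>"
    and "tetrahedral_triangulation \<Omega> \<T>"
    and "T > 0" and "L > 0" and "k = T / real L"
    and "\<alpha> \<ge> 0" and "l_ex > 0" and "0 \<le> \<theta>" and "\<theta> \<le> 1"
  shows "\<forall>m :: nat \<Rightarrow> real^3 \<Rightarrow> real^3. \<forall>l<L. m l \<in> S1_vec \<Omega> \<T> \<longrightarrow>
           (\<exists>!v. v \<in> S1_vec \<Omega> \<T> \<and> predictor_eq \<Omega> \<T> \<alpha> l_ex \<theta> k (m l) v) \<and>
           (\<forall>v\<in>S1_vec \<Omega> \<T>. predictor_eq \<Omega> \<T> \<alpha> l_ex \<theta> k (m l) v \<longrightarrow>
              (\<exists>!m'. m' \<in> S1_vec \<Omega> \<T> \<and> corrector_eq \<Omega> \<T> \<alpha> l_ex k (m l) v m'))"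
proof -
  interpret tetrahedral_mesh \<Omega> \<T>
    using assms(1,2) by unfold_locales (auto simp: bounded_lipschitz_domain_def)
  have "k > 0" using assms by simp
  moreover have "0 \<le> \<theta> * k" using assms \<open>k > 0\<close> by simp
  ultimately show ?thesis using predictor_unique corrector_unique assms(6) by simp
qed

end
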